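(* Let $\mathcal N=\mathbb N^{\mathbb N}$, let $2=\{0,1\}$ be the discrete two-point space, and let $\mathcal C(\mathcal N,2)$ be the represented space of continuous functions from $\mathcal N$ to $2$ (clopen subsets of $\mathcal N$). The space $\mathcal C(\mathcal N,2)$ is not $\mathbb N\langle2\rangle$-based, where $\mathbb N\langle 2\rangle=\mathcal C(\mathcal N,\mathbb N)$. Moreover, the computable open subsets of $\mathcal C(\mathcal N,2)$ are not $\Sigma^1_2$-enumerable and are not enumerable relative to any $\Delta^1_2$ oracle.
   Context: A represented space is a pair $\mathbf X=(X,\delta_X)$ with $\delta_X:\subseteq\mathcal N\to X$ a partial surjective map; $p$ is a name of $x$ if $\delta_X(p)=x$; $x$ is computable if it has a computable name. A function $f:\mathbf X\to\mathbf Y$ is continuous (resp. computable, computable relative to an oracle $A$) if there is a continuous (resp. computable, $A$-computable) realizer $F:\mathrm{dom}(\delta_X)\to\mathrm{dom}(\delta_Y)$ with $\delta_Y(F(p))=f(\delta_X(p))$ for all $p$. The topology of $\mathbf X$ is the final topology of $\delta_X$. $\mathbb N$ and $2$ are represented by $p\mapsto p(0)$ (with $p(0)\in\{0,1\}$ for $2$), $\mathcal N$ by the identity; subsets carry the restricted representation. $\mathcal C(\mathbf X,\mathbf Y)$ is the represented space of continuous functions, a name of $f$ being a standard effective encoding in $\mathcal N$ of any continuous realizer of $f$. The Sierpiński space is $\mathbb S=\{\bot,\top\}$ with $\delta_{\mathbb S}(0^{\mathbb N})=\bot$, $\delta_{\mathbb S}(p)=\top$ for $p\ne0^{\mathbb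 N}$. $\mathcal O(\mathbf X)=\mathcal C(\mathbf X,\mathbb S)$ is the represented space of open subsets; a computable open subset of $\mathbf X$ is a computable point of $\mathcal O(\mathbf X)$. $\mathbf X$ is $\mathbf Y$-based if there is a continuous function $\mathbf Y\to\mathcal O(\mathbf X)$ whose image is a basis of the topology of $\mathbf X$. The computable open subsets of $\mathbf X$ are $\Sigma^1_k$-enumerable if the set of them is the image of some lightface $\Sigma^1_k$ set $S\subseteq\mathbb N$ under a computable function $S\to\mathcal O(\mathbf X)$. They are enumerable relative to an oracle $A\subseteq\mathbb N$ if there is a function $\mathbb N\to\mathcal O(\mathbf X)$, computable relative to $A$, whose range contains all of them; a $\Delta^1_k$ oracle is a lightface $\Delta^1_k$ subset of $\mathbb N$. *)

theory Defs
  imports "HOL-Analysis.Analysis" "HOL-Library.Nat_Bijection"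
begin

section \<open>Computability relative to a point of Baire space\<close>

text \<open>The topology on Baire space is the product topology of HOL-Analysis.\<close>

type_synonym baire = "nat \<Rightarrow> nat"

datatype recf =
    Zero
  | Succ
  | Proj nat
  | Query
  | Comp recf "recf list"
  | Prec recf recf
  | Minim recf

text \<open>
  Partial recursive functions with access to \<open>p\<close> through \<open>Query\<close>; \<open>None\<close> means divergence (or a
  wrong number of arguments). In \<open>Prec\<close> and \<open>Minim\<close> the recursion variable comes first.
\<close>

fun eval :: "recf \<Rightarrow> baire \<Rightarrow> nat list \<Rightarrow> nat option" where
  "eval Zero p xs = Some 0"
| "eval Succ p xs = (case xs of [x] \<Rightarrow> Some (Suc x) | _ \<Rightarrow> None)"
| "eval (Proj i) p xs = (if i < length xs then Some (xs ! i) else None)"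
| "eval Query p xs = (case xs of [x] \<Rightarrow> Some (p x) | _ \<Rightarrow> None)"
| "eval (Comp f gs) p xs =
     (case those (map (\<lambda>g. eval g p xs) gs) of None \<Rightarrow> None | Some ys \<Rightarrow> eval f p ys)"
| "eval (Prec f g) p xs =
     (case xs of
        [] \<Rightarrow> None
      | n # ys \<Rightarrow>
          rec_nat (eval f p ys)
            (\<lambda>m r. case r of None \<Rightarrow> None | Some v \<Rightarrow> eval g p (m # v # ys)) n)"
| "eval (Minim f) p xs =
     (if \<exists>y. eval f p (y # xs) = Some 0 \<and> (\<forall>z<y. \<exists>v. eval f p (z # xs) = Some (Suc v))
      then Some (LEAST y. eval f p (y # xs) = Some 0)
      else None)"

definition join :: "baire \<Rightarrow> baire \<Rightarrow> baire" where
  "join p q = (\<lambda>n. if even n then p (n div 2) else q (n div 2))"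

definition computable_point :: "baire \<Rightarrow> bool" where
  "computable_point p \<longleftrightarrow> (\<exists>e. \<forall>n. eval e (\<lambda>_. 0) [n] = Some (p n))"

definition computable_on :: "baire set \<Rightarrow> (baire \<Rightarrow> baire) \<Rightarrow> bool" where
  "computable_on D F \<longleftrightarrow> (\<exists>e. \<forall>p\<in>D. \<forall>n. eval e p [n] = Some (F p n))"

definition computable_on_rel :: "nat set \<Rightarrow> baire set \<Rightarrow> (baire \<Rightarrow> baire) \<Rightarrow> bool" where
  "computable_on_rel A D F \<longleftrightarrow>
     (\<exists>e. \<forall>p\<in>D. \<forall>n. eval e (join p (\<lambda>i. of_bool (i \<in> A))) [n] = Some (F p n))"


section \<open>The lightface projective hierarchy\<close>

text \<open>
  Pointsets are subsets of the product of Baire space and \<open>\<nat>\<close>, given as binary predicates; several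
  function arguments are merged by \<^const>\<open>join\<close>. A semirecursive predicate is a lightface
  \<open>\<Sigma>\<^sup>0\<^sub>1\<close> pointset.
\<close>

definition semirecursive :: "(baire \<Rightarrow> nat \<Rightarrow> bool) \<Rightarrow> bool" where
  "semirecursive P \<longleftrightarrow> (\<exists>e. \<forall>p n. P p n \<longleftrightarrow> eval e p [n] \<noteq> None)"

text \<open>
  \<open>\<Sigma>\<^sup>1\<^sub>1\<close> pointsets are the projections of \<open>\<Pi>\<^sup>0\<^sub>1\<close> ones and \<open>\<Sigma>\<^sup>1\<^sub>k\<^sub>+\<^sub>1\<close> pointsets are the projections
  of \<open>\<Pi>\<^sup>1\<^sub>k\<close> ones. There is no level 0.
\<close>

inductive Sigma1 :: "nat \<Rightarrow> (baire \<Rightarrow> nat \<Rightarrow> bool) \<Rightarrow> bool" where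
  base: "semirecursive (\<lambda>p n. \<not> Q p n) \<Longrightarrow> Sigma1 1 (\<lambda>p n. \<exists>q. Q (join q p) n)"
| step: "Sigma1 k (\<lambda>p n. \<not> Q p n) \<Longrightarrow> Sigma1 (Suc k) (\<lambda>p n. \<exists>q. Q (join q p) n)"

definition Sigma1_set :: "nat \<Rightarrow> nat set \<Rightarrow> bool" where
  "Sigma1_set k S \<longleftrightarrow> Sigma1 k (\<lambda>p n. n \<in> S)"

definition Delta1_set :: "nat \<Rightarrow> nat set \<Rightarrow> bool" where
  "Delta1_set k S \<longleftrightarrow> Sigma1_set k S \<and> Sigma1_set k (- S)"


section \<open>Represented spaces\<close>

text \<open>
  A represented space is given by its representation, a partial map on Baire space. The underlying
  set is its range, so that surjectivity is built in.
\<close>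

type_synonym 'a represented = "baire \<rightharpoonup> 'a"

abbreviation carrier :: "'a represented \<Rightarrow> 'a set" where
  "carrier X \<equiv> ran X"

definition computable_element :: "'a represented \<Rightarrow> 'a \<Rightarrow> bool" where
  "computable_element X x \<longleftrightarrow> (\<exists>p. computable_point p \<and> X p = Some x)"

definition subspace_of :: "'a represented \<Rightarrow> 'a set \<Rightarrow> 'a represented" where
  "subspace_of X S = (\<lambda>p. case X p of None \<Rightarrow> None | Some x \<Rightarrow> if x \<in> S then Some x else None)"

text \<open>
  \<open>F\<close> is a realizer of the restriction of \<open>f\<close> to the carrier of \<open>X\<close>; in particular \<open>F\<close> maps
  \<open>dom X\<close> to \<open>dom Y\<close> and \<open>f\<close> maps the carrier of \<open>X\<close> to that of \<open>Y\<close>.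
\<close>

definition realizes :: "'a represented \<Rightarrow> 'b represented \<Rightarrow> (baire \<Rightarrow> baire) \<Rightarrow> ('a \<Rightarrow> 'b) \<Rightarrow> bool" where
  "realizes X Y F f \<longleftrightarrow> (\<forall>p x. X p = Some x \<longrightarrow> Y (F p) = Some (f x))"

definition continuous_fun :: "'a represented \<Rightarrow> 'b represented \<Rightarrow> ('a \<Rightarrow> 'b) \<Rightarrow> bool" where
  "continuous_fun X Y f \<longleftrightarrow> (\<exists>F. continuous_on (dom X) F \<and> realizes X Y F f)"

definition computable_fun :: "'a represented \<Rightarrow> 'b represented \<Rightarrow> ('a \<Rightarrow> 'b) \<Rightarrow> bool" where
  "computable_fun X Y f \<longleftrightarrow> (\<exists>F. computable_on (dom X) F \<and> realizes X Y F f)"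

definition computable_fun_rel ::
    "nat set \<Rightarrow> 'a represented \<Rightarrow> 'b represented \<Rightarrow> ('a \<Rightarrow> 'b) \<Rightarrow> bool" where
  "computable_fun_rel A X Y f \<longleftrightarrow> (\<exists>F. computable_on_rel A (dom X) F \<and> realizes X Y F f)"

definition final_topology :: "'a represented \<Rightarrow> 'a topology" where
  "final_topology X =
     topology (\<lambda>U. U \<subseteq> carrier X \<and> openin (top_of_set (dom X)) {p. \<exists>x\<in>U. X p = Some x})"

lemma openin_final_topology:
  "openin (final_topology X) U \<longleftrightarrow>
     U \<subseteq> carrier X \<and> openin (top_of_set (dom X)) {p. \<exists>x\<in>U. X p = Some x}"
proof -
  have Int: "{p. \<exists>x\<in>S \<inter> T. X p = Some x} = {p. \<exists>x\<in>S. X p = Some x} \<inter> {p. \<exists>x\<in>T. X p = Some x}"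
    for S T by auto
  have Union: "{p. \<exists>x\<in>\<Union>\<K>. X p = Some x} = (\<Union>K\<in>\<K>. {p. \<exists>x\<in>K. X p = Some x})" for \<K>
    by auto
  have "istopology (\<lambda>U. U \<subseteq> carrier X \<and>
          openin (top_of_set (dom X)) {p. \<exists>x\<in>U. X p = Some x})"
    unfolding istopology_def Int Union
    by (intro conjI allI impI openin_Int openin_Union) auto
  then show ?thesis
    by (simp add: final_topology_def topology_inverse')
qed


subsection \<open>Natural numbers, Baire space and the Sierpinski space\<close>

definition nat_space :: "nat represented" where
  "nat_space = (\<lambda>p. Some (p 0))"

definition two_space :: "nat represented" where
  "two_space = subspace_of nat_space {0, 1}"

definition baire_space :: "baire represented" where
  "baire_space = Some"

datatype sierpinski = Bot | Top

definition sierpinski_space :: "sierpinski represented" where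
  "sierpinski_space = (\<lambda>p. Some (if p = (\<lambda>_. 0) then Bot else Top))"


subsection \<open>Function spaces\<close>

text \<open>
  Names of continuous functions are Kleene associates: to find the value at \<open>n\<close> of the image of
  \<open>p\<close>, evaluate \<open>q\<close> on longer and longer prefixes of \<open>p\<close>. The value 0 means that the prefix is
  too short, and the first value of the form \<open>Suc v\<close> gives the answer \<open>v\<close>.
\<close>

definition prefix_code :: "nat \<Rightarrow> baire \<Rightarrow> nat \<Rightarrow> nat" where
  "prefix_code n p k = list_encode (n # map p [0..<k])"

definition encodes_on :: "baire set \<Rightarrow> baire \<Rightarrow> (baire \<Rightarrow> baire) \<Rightarrow> bool" where
  "encodes_on D q F \<longleftrightarrow>
     (\<forall>p\<in>D. \<forall>n. \<exists>k. q (prefix_code n p k) = Suc (F p n) \<and> (\<forall>j<k. q (prefix_code n p j) = 0))"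

text \<open>
  Functions on a represented space are taken to be \<^const>\<open>undefined\<close> outside its carrier, so that
  distinct elements of the function space differ at some point of the carrier.
\<close>

definition names_fun :: "'a represented \<Rightarrow> 'b represented \<Rightarrow> baire \<Rightarrow> ('a \<Rightarrow> 'b) \<Rightarrow> bool" where
  "names_fun X Y q f \<longleftrightarrow>
     f \<in> extensional (carrier X) \<and>
     (\<exists>F. continuous_on (dom X) F \<and> realizes X Y F f \<and> encodes_on (dom X) q F)"

definition fun_space :: "'a represented \<Rightarrow> 'b represented \<Rightarrow> ('a \<Rightarrow> 'b) represented" where
  "fun_space X Y = (\<lambda>q. if \<exists>f. names_fun X Y q f then Some (THE f. names_fun X Y q f) else None)"

lemma encodes_on_unique:
  assumes "encodes_on D q F" "encodes_on D q G" "p \<in> D"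
  shows "F p = G p"
proof
  fix n
  obtain k where k: "q (prefix_code n p k) = Suc (F p n)" "\<forall>j<k. q (prefix_code n p j) = 0"
    using assms unfolding encodes_on_def by blast
  obtain l where l: "q (prefix_code n p l) = Suc (G p n)" "\<forall>j<l. q (prefix_code n p j) = 0"
    using assms unfolding encodes_on_def by blast
  have "k = l"
    using k l by (metis linorder_neqE_nat nat.distinct(1))
  then show "F p n = G p n"
    using k l by simp
qed

lemma names_fun_unique:
  assumes "names_fun X Y q f" "names_fun X Y q g"
  shows "f = g"
proof -
  obtain F G where F: "realizes X Y F f" "encodes_on (dom X) q F"
    and G: "realizes X Y G g" "encodes_on (dom X) q G"
    using assms unfolding names_fun_def by blast
  have "f x = g x" if x: "x \<in> carrier X" for x
  proof -
    obtain p where p: "X p = Some x"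
      using x by (auto simp: ran_def)
    then have "F p = G p"
      using encodes_on_unique F G by blast
    then show ?thesis
      using F(1) G(1) p unfolding realizes_def by (metis option.inject)
  qed
  then show ?thesis
    using assms unfolding names_fun_def by (blast intro: extensionalityI)
qed

lemma fun_space_eq_Some: "fun_space X Y q = Some f \<longleftrightarrow> names_fun X Y q f"
proof
  show "names_fun X Y q f" if "fun_space X Y q = Some f"
    using that theI'[of "names_fun X Y q"] names_fun_unique
    unfolding fun_space_def by (metis option.distinct(1) option.inject)
  show "fun_space X Y q = Some f" if f: "names_fun X Y q f"
  proof -
    have "(THE g. names_fun X Y q g) = f"
      by (rule the_equality[where P = "names_fun X Y q", OF f]) (rule names_fun_unique[OF _ f])
    moreover have "\<exists>g. names_fun X Y q g"
      by (rule exI[of "names_fun X Y q" f, OF f])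
    ultimately show ?thesis
      unfolding fun_space_def by simp
  qed
qed

lemma ex_encodes_on:
  assumes "continuous_on D F"
  shows "\<exists>q. encodes_on D q F"
proof -
  define dec where "dec n p k \<longleftrightarrow> (\<forall>p'\<in>D. (\<forall>i<k. p' i = p i) \<longrightarrow> F p' n = F p n)" for n p k
  define q where "q c = (if \<exists>n p k. p \<in> D \<and> c = prefix_code n p k \<and> dec n p k
      then Suc (SOME v. \<exists>n p k. p \<in> D \<and> c = prefix_code n p k \<and> dec n p k \<and> v = F p n)
      else 0)" for c
  have code_eq: "n = m \<and> k = l \<and> (\<forall>i<k. p' i = p i)"
    if "prefix_code n p k = prefix_code m p' l" for n m p p' k l
  proof -
    have eq: "n # map p [0..<k] = m # map p' [0..<l]"
      using that unfolding prefix_code_def by (simp only: list_encode_eq)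
    then have "k = l"
      by (auto dest: map_eq_imp_length_eq)
    then show ?thesis
      using eq by auto
  qed
  have transfer: "dec n p k \<and> F p' m = F p n"
    if "p \<in> D" "p' \<in> D" "prefix_code n p k = prefix_code m p' l" "dec m p' l" for n m p p' k l
  proof -
    have "n = m" "k = l" and agree: "\<forall>i<k. p' i = p i"
      using code_eq[OF that(3)] by blast+
    moreover have "F p n = F p' n"
      using that(1,4) calculation unfolding dec_def by simp
    ultimately show ?thesis
      using that(4) unfolding dec_def by simp
  qed
  have q_dec: "q (prefix_code n p k) = Suc (F p n)" if "p \<in> D" "dec n p k" for n p k
  proof -
    let ?Q = "\<lambda>v. \<exists>m p' l. p' \<in> D \<and> prefix_code n p k = prefix_code m p' l \<and> dec m p' l \<and> v = F p' m"
    have "?Q (F p n)"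
      using that by blast
    then have "?Q (SOME v. ?Q v)"
      by (rule someI)
    then obtain m p' l where "p' \<in> D" "prefix_code n p k = prefix_code m p' l" "dec m p' l"
        and some: "(SOME v. ?Q v) = F p' m"
      by (elim exE conjE)
    then have "(SOME v. ?Q v) = F p n"
      using transfer[OF that(1)] by simp
    moreover have "\<exists>m p' l. p' \<in> D \<and> prefix_code n p k = prefix_code m p' l \<and> dec m p' l"
      using that by blast
    ultimately show ?thesis
      unfolding q_def by simp
  qed
  have q_not_dec: "q (prefix_code n p k) = 0" if "p \<in> D" "\<not> dec n p k" for n p k
  proof -
    have "\<not> (\<exists>m p' l. p' \<in> D \<and> prefix_code n p k = prefix_code m p' l \<and> dec m p' l)"
      using transfer[OF that(1)] that(2) by blast
    then show ?thesis
      unfolding q_def by simp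
  qed
  have ex_dec: "\<exists>k. dec n p k" if "p \<in> D" for n p
  proof -
    have "continuous_on D (\<lambda>p. F p n)"
      using assms by (rule continuous_on_product_then_coordinatewise)
    then have "openin (top_of_set D) (D \<inter> (\<lambda>p. F p n) -` {F p n})"
      using continuous_openin_preimage_gen open_discrete by blast
    then obtain T where T: "open T" "D \<inter> (\<lambda>p. F p n) -` {F p n} = D \<inter> T"
      by (auto simp: openin_open)
    then have "p \<in> T"
      using that by blast
    then obtain U where U: "p \<in> Pi\<^sub>E UNIV U" "finite {i. U i \<noteq> UNIV}" "Pi\<^sub>E UNIV U \<subseteq> T"
      using product_topology_open_contains_basis[of "\<lambda>_. euclidean" UNIV T p] T(1)
      by (auto simp: open_fun_def)
    obtain k where k: "\<forall>i. U i \<noteq> UNIV \<longrightarrow> i < k"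
      using U(2) by (auto simp: finite_nat_set_iff_bounded)
    have "F p' n = F p n" if "p' \<in> D" "\<forall>i<k. p' i = p i" for p'
    proof -
      have "p' i \<in> U i" for i
        using that k U(1) by (cases "U i = UNIV") (auto simp: PiE_iff)
      then have "p' \<in> D \<inter> T"
        using U(3) that by (auto simp: PiE_iff)
      then show ?thesis
        using T(2) by blast
    qed
    then show ?thesis
      unfolding dec_def by blast
  qed
  have "encodes_on D q F"
    unfolding encodes_on_def
  proof (intro ballI allI)
    fix p n
    assume p: "p \<in> D"
    define k where "k = (LEAST k. dec n p k)"
    have "dec n p k"
      unfolding k_def using ex_dec[OF p] by (rule LeastI_ex)
    moreover have "\<forall>j<k. \<not> dec n p j"
      unfolding k_def using not_less_Least by blast
    ultimately have "q (prefix_code n p k) = Suc (F p n) \<and> (\<forall>j<k. q (prefix_code n p j) = 0)"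
      using q_dec[OF p] q_not_dec[OF p] by simp
    then show "\<exists>k. q (prefix_code n p k) = Suc (F p n) \<and> (\<forall>j<k. q (prefix_code n p j) = 0)"
      by (rule exI)
  qed
  then show ?thesis
    by (rule exI[of "\<lambda>q. encodes_on D q F" q])
qed

lemma carrier_fun_space:
  "carrier (fun_space X Y) = {f \<in> extensional (carrier X). continuous_fun X Y f}"
proof (rule set_eqI)
  fix f
  have "f \<in> carrier (fun_space X Y) \<longleftrightarrow> (\<exists>q. names_fun X Y q f)"
    by (simp add: ran_def fun_space_eq_Some)
  also have "\<dots> \<longleftrightarrow> f \<in> extensional (carrier X) \<and> continuous_fun X Y f"
    unfolding names_fun_def continuous_fun_def by (blast dest: ex_encodes_on)
  finally show "f \<in> carrier (fun_space X Y) \<longleftrightarrow>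
      f \<in> {f \<in> extensional (carrier X). continuous_fun X Y f}"
    by simp
qed


subsection \<open>Open subsets, bases and enumerability\<close>

definition open_space :: "'a represented \<Rightarrow> ('a \<Rightarrow> sierpinski) represented" where
  "open_space X = fun_space X sierpinski_space"

definition open_set_of :: "'a represented \<Rightarrow> ('a \<Rightarrow> sierpinski) \<Rightarrow> 'a set" where
  "open_set_of X u = {x \<in> carrier X. u x = Top}"

definition basis_of :: "'a topology \<Rightarrow> 'a set set \<Rightarrow> bool" where
  "basis_of T \<B> \<longleftrightarrow>
     (\<forall>B\<in>\<B>. openin T B) \<and> (\<forall>U. openin T U \<longrightarrow> (\<exists>\<B>'\<subseteq>\<B>. \<Union>\<B>' = U))"

definition based_on :: "'a represented \<Rightarrow> 'b represented \<Rightarrow> bool" where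
  "based_on X Y \<longleftrightarrow>
     (\<exists>f. continuous_fun Y (open_space X) f \<and>
          basis_of (final_topology X) ((\<lambda>y. open_set_of X (f y)) ` carrier Y))"

definition computable_opens :: "'a represented \<Rightarrow> ('a \<Rightarrow> sierpinski) set" where
  "computable_opens X = {u. computable_element (open_space X) u}"

definition Sigma1_enumerable_opens :: "nat \<Rightarrow> 'a represented \<Rightarrow> bool" where
  "Sigma1_enumerable_opens k X \<longleftrightarrow>
     (\<exists>S f. Sigma1_set k S \<and> computable_fun (subspace_of nat_space S) (open_space X) f \<and>
            f ` S = computable_opens X)"

definition enumerable_opens_rel :: "nat set \<Rightarrow> 'a represented \<Rightarrow> bool" where
  "enumerable_opens_rel A X \<longleftrightarrow>
     (\<exists>f. computable_fun_rel A nat_space (open_space X) f \<and> computable_opens X \<subseteq> range f)"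

end

theory Submission
  imports Defs
begin

text \<open>
  Let \<open>X\<close> be the space of clopen subsets of Baire space. Each of the three claims says that some
  family of names of open subsets of \<open>X\<close> fails to produce a certain open set, and in each case the
  family has the same shape: it is the continuous image of a set of codes \<open>r\<close> in Baire space cut
  out by a condition of the form ``for all \<open>p\<close> there is a \<open>k\<close> with \<open>\<tau> r p k\<close>'', where \<open>\<tau> r p k\<close>
  depends only on the first \<open>k\<close> values of \<open>r\<close> and \<open>p\<close>. This is well-foundedness of a tree computed
  from \<open>r\<close>. The even-numbered sections of a well-founded \<open>r\<close> are names of open sets, and the core of
  the proof is a single open set \<open>W\<close>, independent of \<open>r\<close>, that is not the union of the sets named by
  \<open>r\<close>, for any well-founded \<open>r\<close> (\<open>diagonal_open_differs\<close>). Moreover \<open>W\<close> is computable if \<open>\<tau>\<close> is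
  decidable (\<open>diagonal_open_computable\<close>).

  The diagonalisation exploits that \<open>X\<close> is not countably based. A point of \<open>X\<close> can carry a natural
  number \<open>a\<close> as the clopen set \<open>{p. p a is odd}\<close>. This set is not constant on any cylinder given by at
  most \<open>a\<close> values, so a name that commits itself after reading \<open>h\<close> values of its argument rules out
  all \<open>a \<ge> h\<close>, and only finitely many candidates remain to be tested. In the same way a point carries
  a code \<open>r\<close> and the time at which each \<open>p\<close> leaves the tree of \<open>r\<close>; as the point is a total continuous
  function, passing all the tests forces \<open>r\<close> to be well-founded. Besides \<open>r\<close>, a point carries a
  position in a copy of Arens' space: points \<open>x\<^sub>r\<close>, \<open>x\<^sub>r\<^sub>,\<^sub>n\<close>, \<open>x\<^sub>r\<^sub>,\<^sub>n\<^sub>,\<^sub>m\<close> such that \<open>x\<^sub>r\<^sub>,\<^sub>n\<close> tends to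
  \<open>x\<^sub>r\<close> as \<open>n\<close> grows and \<open>x\<^sub>r\<^sub>,\<^sub>n\<^sub>,\<^sub>m\<close> tends to \<open>x\<^sub>r\<^sub>,\<^sub>n\<close> as \<open>m\<close> grows, whereas no sequence
  \<open>x\<^sub>r\<^sub>,\<^sub>n\<^sub>,\<^sub>m\<close> with increasing \<open>n\<close> tends to \<open>x\<^sub>r\<close>. The number \<open>m\<close> is carried by the clopen
  set \<open>{p. p n = m}\<close>, which again is not constant on cylinders given by at most \<open>n\<close> values.

  Let \<open>U\<close> be the union of the sets named by a well-founded \<open>r\<close>. If \<open>x\<^sub>r\<close> is seen to lie in \<open>U\<close> at
  stage \<open>l\<close>, then the two limits provide some \<open>n \<ge> l\<close> and \<open>m\<close> such that \<open>x\<^sub>r\<^sub>,\<^sub>n\<^sub>,\<^sub>m\<close> lies in \<open>U\<close>; the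
  first such point that is found is removed. Let \<open>W\<close> be the complement of the set of all removed
  points. If \<open>x\<^sub>r\<close> is not in \<open>U\<close>, it belongs to \<open>W\<close>, and otherwise the removed point belongs to \<open>U\<close>
  but not to \<open>W\<close> (\<open>diagonal\<close>). It remains to see that \<open>W\<close> is open: if \<open>x\<close> is not removed, a finite part
  of a name of \<open>x\<close> must show this (\<open>evidence_iff\<close>). The name determines the only possible code \<open>r\<close>.
  Suppose that it commits itself on the part carrying \<open>m\<close> after reading \<open>h\<close> values. Then \<open>x\<close> cannot be
  a point \<open>x\<^sub>r\<^sub>,\<^sub>n\<^sub>,\<^sub>m\<close> with \<open>n \<ge> h\<close>, hence cannot be removed unless \<open>x\<^sub>r\<close> is seen to lie in \<open>U\<close> by stage \<open>h\<close>. If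
  it is seen by then, the removed point for \<open>r\<close> is found after finitely many steps and compared
  with \<open>x\<close>.

  For the first claim, the names of elements of \<open>\<nat>\<langle>2\<rangle>\<close> are themselves given by such a condition, and
  as \<open>X\<close> is hereditarily Lindelof, every open set is the union of a sequence of sets from the base. For
  the other two, a code consists of an index \<open>n\<close>, a guess for the oracle set, witnesses that \<open>n\<close>
  is a legal index and that the guess is correct, and the resulting name. Membership in a
  \<open>\<Sigma>\<^sup>1\<^sub>2\<close> set, and being the characteristic function of a \<open>\<Delta>\<^sup>1\<^sub>2\<close> set, are conditions of the required
  form once the witnesses are part of the code; no access to the oracle is left, so \<open>W\<close> is computable.
\<close>

section \<open>Recursive functions of coded arguments\<close>

text \<open>
Only unary functions are considered. Several arguments are packed with \<^const>\<open>prod_encode\<close>, so that the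
environment of a bound variable is a pair, and closure under bounded quantifiers, search and
recursion can be applied mechanically to terms with nested binders. A parameter that is itself a
function \<open>g\<close> is represented by the hypothesis that \<open>\<lambda>e. g (pfst e) (psnd e)\<close> is recursive.
\<close>

definition total_recursive :: "(nat \<Rightarrow> nat) \<Rightarrow> bool" where
  "total_recursive f \<longleftrightarrow> (\<exists>e. \<forall>p x. eval e p [x] = Some (f x))"

definition decidable :: "(nat \<Rightarrow> bool) \<Rightarrow> bool" where
  "decidable P \<longleftrightarrow> total_recursive (\<lambda>x. of_bool (P x))"

definition pfst :: "nat \<Rightarrow> nat" where "pfst x = fst (prod_decode x)"
definition psnd :: "nat \<Rightarrow> nat" where "psnd x = snd (prod_decode x)"

lemma pfst_prod_encode [simp]: "pfst (prod_encode (a, b)) = a"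
  and psnd_prod_encode [simp]: "psnd (prod_encode (a, b)) = b"
  by (simp_all add: pfst_def psnd_def)

lemma prod_encode_pfst_psnd [simp]: "prod_encode (pfst x, psnd x) = x"
  by (simp add: pfst_def psnd_def)

lemma pfst_0 [simp]: "pfst 0 = 0" and psnd_0 [simp]: "psnd 0 = 0"
  by (simp_all add: pfst_def psnd_def prod_decode_def prod_decode_aux.simps)

lemma pfst_le: "pfst x \<le> x" and psnd_le: "psnd x \<le> x"
  by (metis le_prod_encode_1 prod_encode_pfst_psnd, metis le_prod_encode_2 prod_encode_pfst_psnd)

subsection \<open>Programs for the pairing function\<close>

definition add_prog where "add_prog = Prec (Proj 0) (Comp Succ [Proj 1])"
definition tri_prog where "tri_prog = Prec Zero (Comp add_prog [Comp Succ [Proj 0], Proj 1])"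
definition pair_prog where
  "pair_prog = Comp add_prog [Comp tri_prog [Comp add_prog [Proj 0, Proj 1]], Proj 0]"
definition pred_prog where "pred_prog = Prec Zero (Proj 0)"
definition sub_prog where "sub_prog = Prec (Proj 0) (Comp pred_prog [Proj 1])"
definition root_prog where
  "root_prog = Minim (Comp sub_prog [Comp tri_prog [Comp Succ [Proj 0]], Comp Succ [Proj 1]])"

lemma eval_add: "eval add_prog p [n, x] = Some (n + x)"
  unfolding add_prog_def by (induction n) auto

lemma eval_tri: "eval tri_prog p [n] = Some (triangle n)"
  unfolding tri_prog_def by (induction n) (auto simp: eval_add)

lemma eval_pair: "eval pair_prog p [a, b] = Some (prod_encode (a, b))"
  unfolding pair_prog_def by (simp add: eval_tri eval_add prod_encode_def)

lemma eval_pred: "eval pred_prog p [n] = Some (n - 1)"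
  unfolding pred_prog_def by (induction n) auto

lemma eval_sub: "eval sub_prog p [n, x] = Some (x - n)"
  unfolding sub_prog_def by (induction n) (auto simp: eval_pred)

lemma triangle_mono: "m \<le> n \<Longrightarrow> triangle m \<le> triangle n"
  unfolding triangle_def by (intro div_le_mono mult_le_mono) auto

text \<open>
The components of a pair add up to the index of its diagonal, which can be found by search.
\<close>

lemma triangle_root:
  "(LEAST y. x < triangle (Suc y)) = pfst x + psnd x"
proof -
  have x: "x = triangle (pfst x + psnd x) + pfst x"
    using prod_encode_pfst_psnd[of x] by (simp add: prod_encode_def)
  show ?thesis
  proof (rule Least_equality)
    show "x < triangle (Suc (pfst x + psnd x))"
      using x by simp
    show "pfst x + psnd x \<le> y" if "x < triangle (Suc y)" for y
    proof (rule ccontr)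
      assume "\<not> ?thesis"
      then have "triangle (Suc y) \<le> triangle (pfst x + psnd x)"
        by (intro triangle_mono) simp
      then show False using x that by linarith
    qed
  qed
qed

text \<open>
Inside a total function the side condition of minimization is automatic.
\<close>

lemma eval_Minim_total:
  assumes "\<And>y. eval f p (y # xs) = Some (g y)" "g y = 0"
  shows "eval (Minim f) p xs = Some (LEAST y. g y = 0)"
proof -
  have "g (LEAST y. g y = 0) = 0" using assms(2) by (rule LeastI)
  moreover have "\<forall>z<(LEAST y. g y = 0). \<exists>v. g z = Suc v"
    using not_less_Least not0_implies_Suc by blast
  ultimately show ?thesis by (auto simp: assms(1))
qed

lemma eval_root: "eval root_prog p [x] = Some (pfst x + psnd x)"
proof -
  let ?f = "Comp sub_prog [Comp tri_prog [Comp Succ [Proj 0]], Comp Succ [Proj 1]]"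
  have step: "eval ?f p [y, x] = Some (Suc x - triangle (Suc y))" for y
    by (simp add: eval_sub eval_tri del: triangle_Suc)
  have zero: "Suc x - triangle (Suc y) = 0 \<longleftrightarrow> x < triangle (Suc y)" for y by linarith
  have "Suc x - triangle (Suc (pfst x + psnd x)) = 0"
    using prod_encode_pfst_psnd[of x] by (simp add: prod_encode_def)
  then have "eval (Minim ?f) p [x] = Some (LEAST y. Suc x - triangle (Suc y) = 0)"
    by (rule eval_Minim_total[where g = "\<lambda>y. Suc x - triangle (Suc y)", OF step])
  then show ?thesis
    unfolding zero triangle_root root_prog_def .
qed

definition fst_prog where "fst_prog = Comp sub_prog [Comp tri_prog [root_prog], Proj 0]"
definition snd_prog where "snd_prog = Comp sub_prog [fst_prog, root_prog]"

lemma eval_fst: "eval fst_prog p [x] = Some (pfst x)"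
  unfolding fst_prog_def using prod_encode_pfst_psnd[of x]
  by (simp add: eval_root eval_tri eval_sub prod_encode_def)

lemma eval_snd: "eval snd_prog p [x] = Some (psnd x)"
  unfolding snd_prog_def by (simp add: eval_root eval_fst eval_sub)

subsection \<open>Closure properties\<close>

named_theorems recursive_intros

lemma total_recursive_id [recursive_intros]: "total_recursive (\<lambda>x. x)"
  unfolding total_recursive_def by (rule exI[of _ "Proj 0"]) simp

lemma total_recursive_Suc_comp [recursive_intros]:
  assumes "total_recursive f" shows "total_recursive (\<lambda>x. Suc (f x))"
proof -
  obtain e where "\<forall>p x. eval e p [x] = Some (f x)"
    using assms unfolding total_recursive_def by blast
  then show ?thesis unfolding total_recursive_def by (intro exI[of _ "Comp Succ [e]"]) simp
qed

lemma total_recursive_const [recursive_intros]: "total_recursive (\<lambda>x. c)"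
proof (induction c)
  case 0
  show ?case unfolding total_recursive_def by (rule exI[of _ Zero]) simp
qed (rule total_recursive_Suc_comp)

lemma total_recursive_compose:
  assumes "total_recursive f" "total_recursive g" shows "total_recursive (\<lambda>x. f (g x))"
proof -
  obtain e d where "\<forall>p x. eval e p [x] = Some (f x)" "\<forall>p x. eval d p [x] = Some (g x)"
    using assms unfolding total_recursive_def by blast
  then show ?thesis unfolding total_recursive_def by (intro exI[of _ "Comp e [d]"]) simp
qed

lemma total_recursive_pfst [recursive_intros]:
  "total_recursive f \<Longrightarrow> total_recursive (\<lambda>x. pfst (f x))"
  by (rule total_recursive_compose) (auto simp: total_recursive_def intro!: exI[of _ fst_prog] eval_fst)

lemma total_recursive_psnd [recursive_intros]:
  "total_recursive f \<Longrightarrow> total_recursive (\<lambda>x. psnd (f x))"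
  by (rule total_recursive_compose) (auto simp: total_recursive_def intro!: exI[of _ snd_prog] eval_snd)

lemma total_recursive_prod_encode [recursive_intros]:
  assumes "total_recursive f" "total_recursive g"
  shows "total_recursive (\<lambda>x. prod_encode (f x, g x))"
proof -
  obtain e d where "\<forall>p x. eval e p [x] = Some (f x)" "\<forall>p x. eval d p [x] = Some (g x)"
    using assms unfolding total_recursive_def by blast
  then show ?thesis unfolding total_recursive_def
    by (intro exI[of _ "Comp pair_prog [e, d]"]) (simp add: eval_pair)
qed

text \<open>
Turns the hypothesis on a functional parameter into a rule for applying it to arbitrary terms.
\<close>

lemma total_recursive_compose2:
  assumes "total_recursive (\<lambda>e. f (pfst e) (psnd e))" "total_recursive a" "total_recursive b"
  shows "total_recursive (\<lambda>x. f (a x) (b x))"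
  using total_recursive_compose[OF assms(1) total_recursive_prod_encode[OF assms(2,3)]] by simp

lemma total_recursive_rec_nat [recursive_intros]:
  assumes "total_recursive a" "total_recursive (\<lambda>e. h (pfst e) (pfst (psnd e)) (psnd (psnd e)))"
    and "total_recursive n"
  shows "total_recursive (\<lambda>x. rec_nat (a x) (\<lambda>m v. h m v x) (n x))"
proof -
  obtain ea eh en where ea: "\<And>p x. eval ea p [x] = Some (a x)"
    and eh: "\<And>p x. eval eh p [x] = Some (h (pfst x) (pfst (psnd x)) (psnd (psnd x)))"
    and en: "\<And>p x. eval en p [x] = Some (n x)"
    using assms unfolding total_recursive_def by metis
  let ?P = "Prec ea (Comp eh [Comp pair_prog [Proj 0, Comp pair_prog [Proj 1, Proj 2]]])"
  have "eval ?P p [k, x] = Some (rec_nat (a x) (\<lambda>m v. h m v x) k)" for p k x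
    by (induction k) (auto simp: ea eh eval_pair)
  then show ?thesis unfolding total_recursive_def
    by (intro exI[of _ "Comp ?P [en, Proj 0]"]) (simp add: en del: eval.simps(6))
qed

lemma total_recursive_if [recursive_intros]:
  assumes P: "decidable P" and a: "total_recursive a" and b: "total_recursive b"
  shows "total_recursive (\<lambda>x. if P x then a x else b x)"
proof -
  have "total_recursive (\<lambda>x. rec_nat (b x) (\<lambda>m v. a x) (of_bool (P x)))"
    by (rule total_recursive_rec_nat[OF b _ P[unfolded decidable_def]])
      (intro recursive_intros total_recursive_compose[OF a])
  moreover have "(\<lambda>x. rec_nat (b x) (\<lambda>m v. a x) (of_bool (P x))) = (\<lambda>x. if P x then a x else b x)"
    by auto
  ultimately show ?thesis by simp
qed

lemma decidable_const [recursive_intros]: "decidable (\<lambda>x. c)"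
  unfolding decidable_def by (rule total_recursive_const)

lemma total_recursive_of_bool [recursive_intros]:
  "decidable P \<Longrightarrow> total_recursive (\<lambda>x. of_bool (P x))"
  unfolding decidable_def .

lemma total_recursive_cong: "total_recursive f \<Longrightarrow> (\<And>x. f x = g x) \<Longrightarrow> total_recursive g"
  by (simp add: total_recursive_def)

lemma decidable_cong: "decidable P \<Longrightarrow> (\<And>x. P x = Q x) \<Longrightarrow> decidable Q"
  by (simp add: decidable_def total_recursive_def)

lemma decidable_if:
  assumes "decidable P" "decidable Q" "decidable R"
  shows "decidable (\<lambda>x. if P x then Q x else R x)"
  unfolding decidable_def
  by (rule total_recursive_cong[where f = "\<lambda>x. if P x then of_bool (Q x) else of_bool (R x)"])
    (use assms in \<open>auto intro!: recursive_intros\<close>)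

lemma decidable_not [recursive_intros]: "decidable P \<Longrightarrow> decidable (\<lambda>x. \<not> P x)"
  by (rule decidable_cong[OF decidable_if[of P "\<lambda>_. False" "\<lambda>_. True"]]) (auto intro: decidable_const)

lemma decidable_conj [recursive_intros]:
  "decidable P \<Longrightarrow> decidable Q \<Longrightarrow> decidable (\<lambda>x. P x \<and> Q x)"
  by (rule decidable_cong[OF decidable_if[of P Q "\<lambda>_. False"]]) (auto intro: decidable_const)

lemma decidable_disj [recursive_intros]:
  "decidable P \<Longrightarrow> decidable Q \<Longrightarrow> decidable (\<lambda>x. P x \<or> Q x)"
  by (rule decidable_cong[OF decidable_if[of P "\<lambda>_. True" Q]]) (auto intro: decidable_const)

lemma decidable_imp [recursive_intros]:
  "decidable P \<Longrightarrow> decidable Q \<Longrightarrow> decidable (\<lambda>x. P x \<longrightarrow> Q x)"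
  by (rule decidable_cong[OF decidable_if[of P Q "\<lambda>_. True"]]) (auto intro: decidable_const)

lemma decidable_eq_0: "total_recursive f \<Longrightarrow> decidable (\<lambda>x. f x = 0)"
proof -
  assume f: "total_recursive f"
  have "total_recursive (\<lambda>x. rec_nat 1 (\<lambda>m v. 0) (f x))"
    by (intro recursive_intros f)
  moreover have "rec_nat 1 (\<lambda>m v. 0) n = of_bool (n = 0)" for n :: nat
    by (cases n) auto
  ultimately show ?thesis unfolding decidable_def by (rule total_recursive_cong)
qed

lemma total_recursive_diff [recursive_intros]:
  assumes a: "total_recursive a" and b: "total_recursive b"
  shows "total_recursive (\<lambda>x. a x - b x)"
proof -
  obtain e d where "\<forall>p x. eval e p [x] = Some (b x)" "\<forall>p x. eval d p [x] = Some (a x)"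
    using assms unfolding total_recursive_def by blast
  then show ?thesis unfolding total_recursive_def
    by (intro exI[of _ "Comp sub_prog [e, d]"]) (simp add: eval_sub)
qed

lemma total_recursive_add [recursive_intros]:
  assumes a: "total_recursive a" and b: "total_recursive b"
  shows "total_recursive (\<lambda>x. a x + b x)"
proof -
  obtain e d where "\<forall>p x. eval e p [x] = Some (a x)" "\<forall>p x. eval d p [x] = Some (b x)"
    using assms unfolding total_recursive_def by blast
  then show ?thesis unfolding total_recursive_def
    by (intro exI[of _ "Comp add_prog [e, d]"]) (simp add: eval_add)
qed

lemma total_recursive_mult [recursive_intros]:
  assumes a: "total_recursive a" and b: "total_recursive b"
  shows "total_recursive (\<lambda>x. a x * b x)"
proof -
  have "total_recursive (\<lambda>x. rec_nat 0 (\<lambda>m v. v + b x) (a x))"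
    by (intro recursive_intros a total_recursive_compose[OF b])
  moreover have "rec_nat 0 (\<lambda>m v. v + k) n = n * k" for n k :: nat
    by (induction n) auto
  ultimately show ?thesis by simp
qed

lemma decidable_le [recursive_intros]:
  assumes a: "total_recursive a" and b: "total_recursive b"
  shows "decidable (\<lambda>x. a x \<le> b x)"
  using decidable_eq_0[OF total_recursive_diff[OF a b]] by simp

lemma decidable_less [recursive_intros]:
  assumes a: "total_recursive a" and b: "total_recursive b"
  shows "decidable (\<lambda>x. a x < b x)"
  using decidable_not[OF decidable_le[OF b a]] by (simp add: not_le)

lemma decidable_eq [recursive_intros]:
  assumes a: "total_recursive a" and b: "total_recursive b"
  shows "decidable (\<lambda>x. a x = b x)"
  using decidable_conj[OF decidable_le[OF a b] decidable_le[OF b a]] by (simp add: eq_iff)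

lemma decidable_compose:
  assumes "decidable P" "total_recursive g" shows "decidable (\<lambda>x. P (g x))"
  using total_recursive_compose[OF assms[unfolded decidable_def]] unfolding decidable_def .

lemma decidable_bex [recursive_intros]:
  assumes "decidable (\<lambda>e. P (pfst e) (psnd e))" "total_recursive b"
  shows "decidable (\<lambda>x. \<exists>w<b x. P w x)"
proof -
  have "decidable (\<lambda>e. P (pfst e) (psnd (psnd e)))"
    using decidable_compose[OF assms(1), of "\<lambda>e. prod_encode (pfst e, psnd (psnd e))"]
    by (simp add: recursive_intros)
  then have "total_recursive (\<lambda>x. rec_nat 0 (\<lambda>m v. if P m x then 1 else v) (b x))"
    by (intro recursive_intros assms(2))
  moreover have "rec_nat 0 (\<lambda>m v. if P m x then 1 else v) n = of_bool (\<exists>w<n. P w x)" for n x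
    by (induction n) (auto simp: less_Suc_eq)
  ultimately show ?thesis unfolding decidable_def by (auto intro: total_recursive_cong)
qed

lemma decidable_ball [recursive_intros]:
  assumes "decidable (\<lambda>e. P (pfst e) (psnd e))" "total_recursive b"
  shows "decidable (\<lambda>x. \<forall>w<b x. P w x)"
  using decidable_not[OF decidable_bex[OF decidable_not[OF assms(1)] assms(2)]] by simp

lemma total_recursive_Least [recursive_intros]:
  assumes P: "decidable (\<lambda>e. P (pfst e) (psnd e))" and ex: "\<And>x. \<exists>y. P y x"
  shows "total_recursive (\<lambda>x. LEAST y. P y x)"
proof -
  have "total_recursive (\<lambda>e. of_bool (\<not> P (pfst e) (psnd e)))"
    by (intro recursive_intros P)
  then obtain d where d: "\<And>p x. eval d p [x] = Some (of_bool (\<not> P (pfst x) (psnd x)))"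
    unfolding total_recursive_def by blast
  let ?f = "Comp d [Comp pair_prog [Proj 0, Proj 1]]"
  have f: "eval ?f p [y, x] = Some (of_bool (\<not> P y x))" for p y x
    by (simp add: eval_pair d)
  have "eval (Minim ?f) p [x] = Some (LEAST y. P y x)" for p x
  proof -
    obtain y where "P y x" using ex by blast
    then show ?thesis
      using eval_Minim_total[where g = "\<lambda>y. of_bool (\<not> P y x)", OF f, of y] by simp
  qed
  then show ?thesis unfolding total_recursive_def by blast
qed

lemma total_recursive_div [recursive_intros]:
  assumes "total_recursive a"
  shows "total_recursive (\<lambda>x. a x div 2)"
proof -
  have "total_recursive (\<lambda>x. LEAST y. a x < 2 * Suc y)"
  proof (intro recursive_intros total_recursive_compose[OF assms])
    show "\<exists>y. a x < 2 * Suc y" for x by (rule exI[of _ "a x"]) simp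
  qed
  moreover have "(LEAST y. n < 2 * Suc y) = n div 2" for n :: nat
    by (rule Least_equality) auto
  ultimately show ?thesis by simp
qed

lemma total_recursive_mod [recursive_intros]:
  assumes "total_recursive a"
  shows "total_recursive (\<lambda>x. a x mod 2)"
proof -
  have "total_recursive (\<lambda>x. a x - 2 * (a x div 2))"
    by (intro recursive_intros assms)
  then show ?thesis by (simp add: minus_mult_div_eq_mod)
qed

lemma decidable_even [recursive_intros]:
  assumes "total_recursive a"
  shows "decidable (\<lambda>x. even (a x))"
proof -
  have "decidable (\<lambda>x. a x mod 2 = 0)"
    by (intro recursive_intros assms)
  then show ?thesis by (simp add: even_iff_mod_2_eq_zero)
qed

subsection \<open>Finite sequences\<close>

text \<open>
Finite sequences are coded by \<^const>\<open>list_encode\<close>. The access functions are defined by iterating the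
tail operation, which makes them primitive recursive by inspection; indices beyond the end read 0.
\<close>

definition seq_drop :: "nat \<Rightarrow> nat \<Rightarrow> nat" where
  "seq_drop j w = rec_nat w (\<lambda>_ v. psnd (v - 1)) j"

definition seq_nth :: "nat \<Rightarrow> nat \<Rightarrow> nat" where
  "seq_nth w j = pfst (seq_drop j w - 1)"

definition seq_len :: "nat \<Rightarrow> nat" where
  "seq_len w = (LEAST j. seq_drop j w = 0)"

definition init_code :: "(nat \<Rightarrow> nat) \<Rightarrow> nat \<Rightarrow> nat" where
  "init_code p k = list_encode (map p [0..<k])"

lemma seq_drop_list_encode: "seq_drop j (list_encode xs) = list_encode (drop j xs)"
proof (induction j)
  case (Suc j)
  have "seq_drop (Suc j) (list_encode xs) = psnd (list_encode (drop j xs) - 1)"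
    using Suc by (simp add: seq_drop_def)
  also have "\<dots> = list_encode (drop (Suc j) xs)"
  proof (cases "drop j xs")
    case (Cons y ys)
    then have "drop (Suc j) xs = ys" by (metis drop_Suc list.sel(3) tl_drop)
    then show ?thesis using Cons by simp
  qed simp
  finally show ?case .
qed (simp add: seq_drop_def)

lemma seq_nth_list_encode: "seq_nth (list_encode xs) j = (if j < length xs then xs ! j else 0)"
proof (cases "j < length xs")
  case True
  then show ?thesis by (simp add: seq_nth_def seq_drop_list_encode Cons_nth_drop_Suc[symmetric])
qed (simp add: seq_nth_def seq_drop_list_encode)

lemma list_encode_eq_0 [simp]: "list_encode xs = 0 \<longleftrightarrow> xs = []"
  by (cases xs) auto

lemma seq_len_list_encode [simp]: "seq_len (list_encode xs) = length xs"
  unfolding seq_len_def seq_drop_list_encode by (intro Least_equality) auto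

lemma list_encode_surj: obtains xs where "w = list_encode xs"
  by (metis list_decode_inverse)

lemma seq_nth_init_code: "seq_nth (init_code p k) i = (if i < k then p i else 0)"
  by (simp add: init_code_def seq_nth_list_encode)

lemma seq_len_init_code [simp]: "seq_len (init_code p k) = k"
  by (simp add: init_code_def)

lemma init_code_cong: "(\<And>i. i < k \<Longrightarrow> p i = p' i) \<Longrightarrow> init_code p k = init_code p' k"
  by (auto simp: init_code_def intro!: arg_cong[of _ _ list_encode])

lemma init_code_seq_nth_seq_len: "init_code (seq_nth w) (seq_len w) = w"
proof -
  obtain xs where w: "w = list_encode xs" by (rule list_encode_surj)
  have "map (seq_nth w) [0..<seq_len w] = xs"
    unfolding w by (rule nth_equalityI) (auto simp: seq_nth_list_encode)
  then show ?thesis by (simp add: init_code_def w)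
qed

lemma prefix_code_init_code: "prefix_code n p k = Suc (prod_encode (n, init_code p k))"
  by (simp add: prefix_code_def init_code_def)

lemma list_encode_bounds: "length xs \<le> list_encode xs \<and> (\<forall>x\<in>set xs. x < list_encode xs)"
proof (induction xs)
  case (Cons a xs)
  have "a \<le> prod_encode (a, list_encode xs)" "list_encode xs \<le> prod_encode (a, list_encode xs)"
    by (rule le_prod_encode_1 le_prod_encode_2)+
  then show ?case using Cons by fastforce
qed simp

lemma seq_len_le: "seq_len w \<le> w"
  using list_encode_bounds by (metis seq_len_list_encode list_encode_surj)

lemma seq_nth_le: "seq_nth w i \<le> w"
  by (rule list_encode_surj[of w])
    (use list_encode_bounds in \<open>auto simp: seq_nth_list_encode intro!: less_imp_le\<close>)

lemma seq_nth_less: "i < seq_len w \<Longrightarrow> seq_nth w i < w"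
  by (rule list_encode_surj[of w]) (use list_encode_bounds in \<open>auto simp: seq_nth_list_encode\<close>)

lemma seq_nth_beyond: "seq_len w \<le> i \<Longrightarrow> seq_nth w i = 0"
  by (rule list_encode_surj[of w]) (auto simp: seq_nth_list_encode)

lemma prod_encode_mono:
  "a \<le> a' \<Longrightarrow> b \<le> b' \<Longrightarrow> prod_encode (a, b) \<le> prod_encode (a', b')"
  unfolding prod_encode_def by (simp add: add_mono triangle_mono)

lemma list_encode_append_le: "list_encode xs \<le> list_encode (xs @ ys)"
  by (induction xs) (auto intro: prod_encode_mono)

lemma init_code_mono: "j \<le> k \<Longrightarrow> init_code p j \<le> init_code p k"
  using list_encode_append_le[of "map p [0..<j]" "map p [j..<k]"] upt_add_eq_append[of 0 j "k - j"]
  by (simp add: init_code_def flip: map_append)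

text \<open>
Together with the bounds on the entries of a sequence by its code, this turns bounds on codes into
bounds on everything that a computation reads.
\<close>

lemma prefix_code_mono: "j \<le> k \<Longrightarrow> prefix_code n p j \<le> prefix_code n p k"
  by (simp add: prefix_code_init_code prod_encode_mono init_code_mono)

lemma prefix_code_cong: "(\<And>i. i < k \<Longrightarrow> p i = p' i) \<Longrightarrow> prefix_code n p k = prefix_code n p' k"
  unfolding prefix_code_init_code using init_code_cong[of k p p'] by simp

lemma total_recursive_seq_drop:
  "total_recursive j \<Longrightarrow> total_recursive w \<Longrightarrow> total_recursive (\<lambda>x. seq_drop (j x) (w x))"
  unfolding seq_drop_def by (intro recursive_intros)

lemma total_recursive_seq_nth [recursive_intros]:
  "total_recursive w \<Longrightarrow> total_recursive j \<Longrightarrow> total_recursive (\<lambda>x. seq_nth (w x) (j x))"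
  unfolding seq_nth_def by (intro recursive_intros total_recursive_seq_drop)

lemma total_recursive_seq_len [recursive_intros]:
  assumes "total_recursive w" shows "total_recursive (\<lambda>x. seq_len (w x))"
  unfolding seq_len_def
proof (intro recursive_intros total_recursive_seq_drop total_recursive_compose[OF assms])
  show "\<exists>j. seq_drop j (w x) = 0" for x
    by (rule list_encode_surj[of "w x"]) (auto simp: seq_drop_list_encode intro: exI[of _ "length _"])
qed

text \<open>
The code has to be built from the last entry backwards.
\<close>

lemma init_code_rec: "init_code p k = rec_nat 0 (\<lambda>j v. Suc (prod_encode (p (k - Suc j), v))) k"
proof -
  have "rec_nat 0 (\<lambda>j v. Suc (prod_encode (p (k - Suc j), v))) j = list_encode (map p [k - j..<k])"
    if "j \<le> k" for j
    using that
  proof (induction j)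
    case (Suc j)
    then have "[k - Suc j..<k] = (k - Suc j) # [k - j..<k]"
      by (simp add: upt_rec[of "k - Suc j"] Suc_diff_Suc)
    then show ?case using Suc by simp
  qed simp
  then show ?thesis by (simp add: init_code_def)
qed

lemma total_recursive_init_code [recursive_intros]:
  assumes "total_recursive (\<lambda>e. p (pfst e) (psnd e))" "total_recursive k"
  shows "total_recursive (\<lambda>x. init_code (\<lambda>i. p i x) (k x))"
  unfolding init_code_rec
  by (intro recursive_intros assms total_recursive_compose2[OF assms(1)] total_recursive_compose[OF assms(2)])

lemma total_recursive_prefix_code [recursive_intros]:
  assumes "total_recursive n" "total_recursive (\<lambda>e. p (pfst e) (psnd e))" "total_recursive k"
  shows "total_recursive (\<lambda>x. prefix_code (n x) (\<lambda>i. p i x) (k x))"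
  unfolding prefix_code_init_code by (intro recursive_intros assms)


section \<open>Evaluation with bounded fuel\<close>

definition seq_cons :: "nat \<Rightarrow> nat \<Rightarrow> nat" where
  "seq_cons x w = Suc (prod_encode (x, w))"

text \<open>
The values of \<open>beval\<close> below are options coded as numbers, 0 standing for failure and \<open>Suc v\<close> for the
value \<open>v\<close>; this is \<^const>\<open>seq_cons\<close> lifted to such values.
\<close>

definition seq_cons_opt :: "nat \<Rightarrow> nat \<Rightarrow> nat" where
  "seq_cons_opt y v = (if y = 0 \<or> v = 0 then 0 else Suc (seq_cons (y - 1) (v - 1)))"

text \<open>
The fuel \<open>s\<close> bounds the arguments of oracle queries and the range of every search. Hence a result
depends only on the first \<open>s\<close> values of the oracle, results are stable under increasing \<open>s\<close>, and for a
fixed program the evaluation is a total recursive function of the fuel, the argument and a recursive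
parameter in place of the oracle. No coding of programs is involved.
\<close>

fun beval :: "recf \<Rightarrow> nat \<Rightarrow> baire \<Rightarrow> nat \<Rightarrow> nat" where
  "beval Zero s p w = 1"
| "beval Succ s p w = (if seq_len w = 1 then Suc (Suc (seq_nth w 0)) else 0)"
| "beval (Proj i) s p w = (if i < seq_len w then Suc (seq_nth w i) else 0)"
| "beval Query s p w = (if seq_len w = 1 \<and> seq_nth w 0 < s then Suc (p (seq_nth w 0)) else 0)"
| "beval (Comp f gs) s p w =
     (let v = foldr (\<lambda>g v. seq_cons_opt (beval g s p w) v) gs 1 in if v = 0 then 0 else beval f s p (v - 1))"
| "beval (Prec f g) s p w =
     (if w = 0 then 0
      else rec_nat (beval f s p (seq_drop 1 w))
        (\<lambda>m r. if r = 0 then 0 else beval g s p (seq_cons m (seq_cons (r - 1) (seq_drop 1 w)))) (seq_nth w 0))"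
| "beval (Minim f) s p w =
     (let y = (LEAST y. beval f s p (seq_cons y w) < 2 \<or> s \<le> y)
      in if y < s \<and> beval f s p (seq_cons y w) = 1 then Suc y else 0)"

lemma seq_cons_opt_eq_Suc: "seq_cons_opt y v = Suc u \<longleftrightarrow> (\<exists>a b. y = Suc a \<and> v = Suc b \<and> u = seq_cons a b)"
  by (cases y; cases v) (auto simp: seq_cons_opt_def)

lemma seq_cons_list_encode: "seq_cons x (list_encode xs) = list_encode (x # xs)"
  by (simp add: seq_cons_def)

lemma beval_mono:
  assumes "s \<le> s'" "\<And>i. i < s \<Longrightarrow> p i = p' i" "beval e s p w \<noteq> 0"
  shows "beval e s' p' w = beval e s p w"
  using assms(3)
proof (induction e arbitrary: w)
  case Query
  then show ?case using assms(1,2) by (auto split: if_splits)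
next
  case (Comp f gs)
  have "foldr (\<lambda>g v. seq_cons_opt (beval g s' p' w) v) hs 1 = foldr (\<lambda>g v. seq_cons_opt (beval g s p w) v) hs 1"
    if "set hs \<subseteq> set gs" "foldr (\<lambda>g v. seq_cons_opt (beval g s p w) v) hs 1 \<noteq> 0" for hs
    using that
  proof (induction hs)
    case (Cons h hs)
    then have "beval h s p w \<noteq> 0" "foldr (\<lambda>g v. seq_cons_opt (beval g s p w) v) hs 1 \<noteq> 0"
      by (auto simp: seq_cons_opt_def split: if_splits)
    then show ?case using Cons Comp.IH(2)[of h w] by simp
  qed simp
  then have "foldr (\<lambda>g v. seq_cons_opt (beval g s' p' w) v) gs 1 = foldr (\<lambda>g v. seq_cons_opt (beval g s p w) v) gs 1"
    using Comp.prems by (auto simp: Let_def split: if_splits)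
  then show ?case using Comp.prems Comp.IH(1) by (auto simp: Let_def split: if_splits)
next
  case (Prec f g)
  let ?F = "\<lambda>s p. rec_nat (beval f s p (seq_drop 1 w))
        (\<lambda>m r. if r = 0 then 0 else beval g s p (seq_cons m (seq_cons (r - 1) (seq_drop 1 w))))"
  have "?F s' p' n = ?F s p n" if "?F s p n \<noteq> 0" for n
    using that
  proof (induction n)
    case (Suc n)
    then have "?F s p n \<noteq> 0" by (auto split: if_splits)
    then show ?case using Suc Prec.IH(2) by auto
  qed (use Prec.IH(1) in simp)
  then show ?case using Prec.prems by (auto split: if_splits)
next
  case (Minim f)
  define y where "y = (LEAST y. beval f s p (seq_cons y w) < 2 \<or> s \<le> y)"
  have y: "y < s" "beval f s p (seq_cons y w) = 1"
    using Minim.prems by (auto simp: y_def Let_def split: if_splits)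
  have below: "2 \<le> beval f s p (seq_cons z w)" if "z < y" for z
    using not_less_Least[OF that[unfolded y_def]] by auto
  have "(LEAST y. beval f s' p' (seq_cons y w) < 2 \<or> s' \<le> y) = y"
  proof (rule Least_equality)
    show "beval f s' p' (seq_cons y w) < 2 \<or> s' \<le> y" using Minim.IH[of "seq_cons y w"] y by simp
    show "y \<le> z" if "beval f s' p' (seq_cons z w) < 2 \<or> s' \<le> z" for z
    proof (rule ccontr)
      assume "\<not> y \<le> z"
      then have "2 \<le> beval f s p (seq_cons z w)" by (intro below) simp
      then show False using that Minim.IH[of "seq_cons z w"] y(1) assms(1) \<open>\<not> y \<le> z\<close> by simp
    qed
  qed
  then show ?case using y assms(1) Minim.IH[of "seq_cons y w"] by (simp add: y_def[symmetric] Let_def)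
qed auto

lemma seq_nth_Suc_prod_encode_0 [simp]: "seq_nth (Suc (prod_encode (x, w))) 0 = x"
  by (simp add: seq_nth_def seq_drop_def)

lemma beval_sound: "beval e s p (list_encode xs) = Suc v \<Longrightarrow> eval e p xs = Some v"
proof (induction e arbitrary: xs v)
  case Succ
  then show ?case by (auto simp: seq_nth_list_encode length_Suc_conv split: if_splits)
next
  case (Proj i)
  then show ?case by (auto simp: seq_nth_list_encode split: if_splits)
next
  case Query
  then show ?case by (auto simp: seq_nth_list_encode length_Suc_conv split: if_splits)
next
  case (Comp f gs)
  let ?w = "list_encode xs"
  have "\<exists>ys. u = list_encode ys \<and> those (map (\<lambda>g. eval g p xs) hs) = Some ys"
    if "set hs \<subseteq> set gs" "foldr (\<lambda>g v. seq_cons_opt (beval g s p ?w) v) hs 1 = Suc u" for hs u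
    using that
  proof (induction hs arbitrary: u)
    case (Cons h hs)
    obtain a u' where a: "beval h s p ?w = Suc a" "foldr (\<lambda>g v. seq_cons_opt (beval g s p ?w) v) hs 1 = Suc u'"
      and u: "u = seq_cons a u'"
      using Cons.prems by (auto simp: seq_cons_opt_eq_Suc)
    then show ?case using Cons Comp.IH(2)[of h xs a] by (auto simp: seq_cons_list_encode)
  qed auto
  moreover obtain u where "foldr (\<lambda>g v. seq_cons_opt (beval g s p ?w) v) gs 1 = Suc u" "beval f s p u = Suc v"
    using Comp.prems
    by (cases "foldr (\<lambda>g v. seq_cons_opt (beval g s p ?w) v) gs 1") (simp_all add: Let_def)
  ultimately show ?case using Comp.IH(1) by fastforce
next
  case (Prec f g)
  then obtain n ys where xs: "xs = n # ys" by (cases xs) auto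
  have drop: "seq_drop 1 (list_encode xs) = list_encode ys" "seq_nth (list_encode xs) 0 = n"
    using seq_drop_list_encode[of 1 xs] seq_nth_list_encode[of xs 0] by (auto simp: xs)
  let ?F = "rec_nat (beval f s p (list_encode ys))
        (\<lambda>m r. if r = 0 then 0 else beval g s p (seq_cons m (seq_cons (r - 1) (list_encode ys))))"
  let ?E = "rec_nat (eval f p ys)
            (\<lambda>m r. case r of None \<Rightarrow> None | Some v \<Rightarrow> eval g p (m # v # ys))"
  have "?E k = Some u" if "?F k = Suc u" for k u
    using that
  proof (induction k arbitrary: u)
    case (Suc k)
    then have "?F k \<noteq> 0" by (auto split: if_splits)
    then obtain r where r: "?F k = Suc r" using not0_implies_Suc by blast
    then have "beval g s p (list_encode (k # r # ys)) = Suc u"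
      using Suc.prems by (simp add: seq_cons_def)
    then show ?case using Suc.IH[OF r] Prec.IH(2) by simp
  qed (use Prec.IH(1) in simp)
  then show ?case using Prec.prems unfolding beval.simps drop by (simp add: xs split: if_splits)
next
  case (Minim f)
  let ?w = "list_encode xs"
  define y where "y = (LEAST y. beval f s p (seq_cons y ?w) < 2 \<or> s \<le> y)"
  have y: "v = y" "beval f s p (seq_cons y ?w) = 1" "y < s"
    using Minim.prems by (auto simp: y_def Let_def split: if_splits)
  have below: "\<exists>u. eval f p (z # xs) = Some (Suc u)" if "z < y" for z
  proof -
    have "2 \<le> beval f s p (seq_cons z ?w)"
      using not_less_Least[OF that[unfolded y_def]] by auto
    then obtain u where "beval f s p (seq_cons z ?w) = Suc (Suc u)"
      by (metis One_nat_def Suc_1 Suc_le_D Suc_le_mono)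
    then show ?thesis using Minim.IH[of "z # xs"] by (auto simp: seq_cons_list_encode)
  qed
  have at: "eval f p (y # xs) = Some 0"
    using Minim.IH[of "y # xs"] y(2) by (simp add: seq_cons_list_encode)
  moreover have "(LEAST y. eval f p (y # xs) = Some 0) = y"
    by (rule Least_equality) (use at below in \<open>force simp: not_le[symmetric]\<close>)+
  ultimately show ?case using below y(1) by auto
qed auto

text \<open>
Every halting computation consists of finitely many evaluations, and by monotonicity the largest
of their fuels serves all of them.
\<close>

lemma beval_complete: "eval e p xs = Some v \<Longrightarrow> \<exists>s. beval e s p (list_encode xs) = Suc v"
proof (induction e arbitrary: xs v)
  case Succ
  then show ?case by (auto simp: seq_nth_list_encode split: list.splits)
next
  case (Proj i)
  then show ?case by (auto simp: seq_nth_list_encode split: if_splits)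
next
  case Query
  then show ?case by (auto simp: seq_nth_list_encode split: list.splits)
next
  case (Comp f gs)
  let ?w = "list_encode xs"
  have mono: "foldr (\<lambda>g v. seq_cons_opt (beval g s' p ?w) v) hs 1 = Suc u"
    if "foldr (\<lambda>g v. seq_cons_opt (beval g s p ?w) v) hs 1 = Suc u" "s \<le> s'" for hs s s' u
    using that
  proof (induction hs arbitrary: u)
    case (Cons h hs)
    then have "beval h s p ?w \<noteq> 0" "foldr (\<lambda>g v. seq_cons_opt (beval g s p ?w) v) hs 1 \<noteq> 0"
      by (auto simp: seq_cons_opt_def split: if_splits)
    then obtain u' where "foldr (\<lambda>g v. seq_cons_opt (beval g s p ?w) v) hs 1 = Suc u'"
      using not0_implies_Suc by blast
    then show ?case using Cons beval_mono[of s s' p p h ?w] \<open>beval h s p ?w \<noteq> 0\<close> by simp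
  qed simp
  have "\<exists>s. foldr (\<lambda>g v. seq_cons_opt (beval g s p ?w) v) hs 1 = Suc (list_encode ys)"
    if "set hs \<subseteq> set gs" "those (map (\<lambda>g. eval g p xs) hs) = Some ys" for hs ys
    using that
  proof (induction hs arbitrary: ys)
    case (Cons h hs)
    then obtain a ys' where a: "eval h p xs = Some a"
      "those (map (\<lambda>g. eval g p xs) hs) = Some ys'" "ys = a # ys'"
      by (auto split: option.splits)
    obtain s1 where s1: "beval h s1 p ?w = Suc a" using Comp.IH(2) Cons.prems a(1) by force
    obtain s2 where s2: "foldr (\<lambda>g v. seq_cons_opt (beval g s2 p ?w) v) hs 1 = Suc (list_encode ys')"
      using Cons a(2) by force
    have "beval h (max s1 s2) p ?w = Suc a" using beval_mono[of s1 "max s1 s2" p p h ?w] s1 by simp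
    moreover have "foldr (\<lambda>g v. seq_cons_opt (beval g (max s1 s2) p ?w) v) hs 1 = Suc (list_encode ys')"
      by (rule mono[OF s2]) simp
    ultimately have "foldr (\<lambda>g v. seq_cons_opt (beval g (max s1 s2) p ?w) v) (h # hs) 1 = Suc (list_encode ys)"
      by (simp add: seq_cons_opt_def seq_cons_def a(3))
    then show ?case by blast
  qed auto
  moreover obtain ys where ys: "those (map (\<lambda>g. eval g p xs) gs) = Some ys" "eval f p ys = Some v"
    using Comp.prems by (auto split: option.splits)
  ultimately obtain s1 where s1: "foldr (\<lambda>g v. seq_cons_opt (beval g s1 p ?w) v) gs 1 = Suc (list_encode ys)"
    by blast
  obtain s2 where s2: "beval f s2 p (list_encode ys) = Suc v" using Comp.IH(1) ys by blast
  have "beval f (max s1 s2) p (list_encode ys) = Suc v"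
    using beval_mono[of s2 "max s1 s2" p p f] s2 by simp
  moreover have "foldr (\<lambda>g v. seq_cons_opt (beval g (max s1 s2) p ?w) v) gs 1 = Suc (list_encode ys)"
    by (rule mono[OF s1]) simp
  ultimately have "beval (Comp f gs) (max s1 s2) p ?w = Suc v" by simp
  then show ?case by blast
next
  case (Prec f g)
  then obtain n ys where xs: "xs = n # ys" by (cases xs) auto
  have drop: "seq_drop 1 (list_encode xs) = list_encode ys" "seq_nth (list_encode xs) 0 = n"
    using seq_drop_list_encode[of 1 xs] seq_nth_list_encode[of xs 0] by (auto simp: xs)
  let ?F = "\<lambda>s. rec_nat (beval f s p (list_encode ys))
        (\<lambda>m r. if r = 0 then 0 else beval g s p (seq_cons m (seq_cons (r - 1) (list_encode ys))))"
  let ?E = "rec_nat (eval f p ys)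
            (\<lambda>m r. case r of None \<Rightarrow> None | Some v \<Rightarrow> eval g p (m # v # ys))"
  have mono: "?F s' k = Suc u" if "?F s k = Suc u" "s \<le> s'" for s s' k u
    using that
  proof (induction k arbitrary: u)
    case 0
    then show ?case using beval_mono[of s s' p p f] by simp
  next
    case (Suc k)
    then have "?F s k \<noteq> 0" by (auto split: if_splits)
    then obtain r where r: "?F s k = Suc r" using not0_implies_Suc by blast
    then have "beval g s p (list_encode (k # r # ys)) = Suc u"
      using Suc.prems by (simp add: seq_cons_def)
    then show ?case using Suc.IH[OF r] Suc.prems(2) beval_mono[of s s' p p g] by (simp add: seq_cons_def)
  qed
  have "\<exists>s. ?F s k = Suc u" if "?E k = Some u" for k u
    using that
  proof (induction k arbitrary: u)
    case (Suc k)
    then obtain r where r: "?E k = Some r" "eval g p (k # r # ys) = Some u" by (auto split: option.splits)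
    obtain s1 where s1: "?F s1 k = Suc r" using Suc.IH[OF r(1)] by blast
    obtain s2 where s2: "beval g s2 p (list_encode (k # r # ys)) = Suc u" using Prec.IH(2) r(2) by blast
    have "?F (max s1 s2) k = Suc r" by (rule mono[OF s1]) simp
    moreover have "beval g (max s1 s2) p (list_encode (k # r # ys)) = Suc u"
      using beval_mono[of s2 "max s1 s2" p p g] s2 by simp
    ultimately have "?F (max s1 s2) (Suc k) = Suc u" by (simp add: seq_cons_def)
    then show ?case by blast
  qed (use Prec.IH(1) in simp)
  moreover have "?E n = Some v" using Prec.prems by (simp add: xs)
  ultimately obtain s where "?F s n = Suc v" by blast
  then have "beval (Prec f g) s p (list_encode xs) = Suc v"
    unfolding beval.simps drop by (simp add: xs)
  then show ?case by blast
next
  case (Minim f)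
  let ?w = "list_encode xs"
  obtain y where y: "eval f p (y # xs) = Some 0" "\<forall>z<y. \<exists>v. eval f p (z # xs) = Some (Suc v)"
    using Minim.prems by (auto split: if_splits)
  have vy: "v = y"
  proof -
    have "(LEAST y. eval f p (y # xs) = Some 0) = y"
      by (rule Least_equality) (use y in \<open>force simp: not_le[symmetric]\<close>)+
    then show ?thesis using Minim.prems by (auto split: if_splits)
  qed
  have "\<exists>s. beval f s p (seq_cons z ?w) \<noteq> 0 \<and> (z < y \<longrightarrow> 2 \<le> beval f s p (seq_cons z ?w)) \<and>
      (z = y \<longrightarrow> beval f s p (seq_cons z ?w) = 1)" if z: "z \<le> y" for z
  proof (cases "z = y")
    case True
    obtain s where "beval f s p (seq_cons y ?w) = 1"
      using Minim.IH[OF y(1)] by (auto simp: seq_cons_list_encode)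
    then show ?thesis using True by (intro exI[of _ s]) simp
  next
    case False
    then obtain u where "eval f p (z # xs) = Some (Suc u)" using y(2) z by fastforce
    then obtain s where "beval f s p (seq_cons z ?w) = Suc (Suc u)"
      using Minim.IH[of "z # xs"] unfolding seq_cons_list_encode by blast
    then show ?thesis using False by (intro exI[of _ s]) simp
  qed
  then obtain h where h: "\<And>z. z \<le> y \<Longrightarrow> beval f (h z) p (seq_cons z ?w) \<noteq> 0 \<and>
      (z < y \<longrightarrow> 2 \<le> beval f (h z) p (seq_cons z ?w)) \<and> (z = y \<longrightarrow> beval f (h z) p (seq_cons z ?w) = 1)"
    by metis
  define s where "s = Suc y + (\<Sum>z\<le>y. h z)"
  have at_s: "beval f s p (seq_cons z ?w) = beval f (h z) p (seq_cons z ?w)" if "z \<le> y" for z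
  proof (rule beval_mono)
    have "h z \<le> (\<Sum>z\<le>y. h z)" by (rule member_le_sum) (use that in auto)
    then show "h z \<le> s" unfolding s_def by simp
  qed (use h that in auto)
  have s: "2 \<le> beval f s p (seq_cons z ?w)" if "z < y" for z
    using h[of z] at_s[of z] that by simp
  have sy: "beval f s p (seq_cons y ?w) = 1" using h[of y] at_s[of y] by simp
  have "(LEAST z. beval f s p (seq_cons z ?w) < 2 \<or> s \<le> z) = y"
  proof (rule Least_equality)
    show "y \<le> z" if "beval f s p (seq_cons z ?w) < 2 \<or> s \<le> z" for z
      using that s[of z] by (cases "z < y") (auto simp: s_def)
  qed (simp add: sy)
  then have "beval (Minim f) s p ?w = Suc v"
    by (simp add: sy vy) (simp add: s_def)
  then show ?case by blast
qed auto

lemma eval_iff_beval: "eval e p xs = Some v \<longleftrightarrow> (\<exists>s. beval e s p (list_encode xs) = Suc v)"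
  using beval_sound beval_complete by blast

lemma total_recursive_seq_cons [recursive_intros]:
  "total_recursive a \<Longrightarrow> total_recursive b \<Longrightarrow> total_recursive (\<lambda>x. seq_cons (a x) (b x))"
  unfolding seq_cons_def by (intro recursive_intros)

text \<open>
By recursion on the program; the oracle may depend on further arguments.
\<close>

lemma total_recursive_beval [recursive_intros]:
  assumes p: "total_recursive (\<lambda>e. p (pfst e) (psnd e))" and "total_recursive s" "total_recursive w"
  shows "total_recursive (\<lambda>x. beval e (s x) (\<lambda>i. p i x) (w x))"
  using assms
proof (induction e arbitrary: p s w)
  case Zero
  then show ?case by (simp add: recursive_intros)
next
  case Succ
  then show ?case unfolding beval.simps by (intro recursive_intros)
next
  case (Proj i)
  then show ?case unfolding beval.simps by (intro recursive_intros)
next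
  case Query
  show ?case unfolding beval.simps
    by (intro recursive_intros Query total_recursive_compose2[OF Query(1)])
next
  case (Comp f gs)
  have "total_recursive (\<lambda>x. foldr (\<lambda>g v. seq_cons_opt (beval g (s x) (\<lambda>i. p i x) (w x)) v) hs 1)"
    if "set hs \<subseteq> set gs" for hs
    using that
  proof (induction hs)
    case (Cons h hs)
    then have "total_recursive (\<lambda>x. foldr (\<lambda>g v. seq_cons_opt (beval g (s x) (\<lambda>i. p i x) (w x)) v) hs 1)"
      "total_recursive (\<lambda>x. beval h (s x) (\<lambda>i. p i x) (w x))"
      using Comp.IH(2)[of h] Comp.prems by auto
    then show ?case by (simp add: seq_cons_opt_def del: One_nat_def) (intro recursive_intros)
  qed (simp add: recursive_intros)
  from this[of gs] show ?case
    unfolding beval.simps Let_def by (intro recursive_intros Comp) auto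
next
  case (Prec f g)
  have w: "total_recursive (\<lambda>x. w (g x))" "total_recursive (\<lambda>x. s (g x))" if "total_recursive g" for g
    using total_recursive_compose Prec.prems that by blast+
  show ?case
    unfolding beval.simps
    by (intro recursive_intros Prec w total_recursive_seq_drop total_recursive_compose2[OF Prec.prems(1)])
next
  case (Minim f)
  have w: "total_recursive (\<lambda>x. w (g x))" "total_recursive (\<lambda>x. s (g x))" if "total_recursive g" for g
    using total_recursive_compose Minim.prems that by blast+
  have "total_recursive (\<lambda>x. LEAST y. beval f (s x) (\<lambda>i. p i x) (seq_cons y (w x)) < 2 \<or> s x \<le> y)"
    by (intro recursive_intros Minim w total_recursive_compose2[OF Minim.prems(1)]) auto
  then show ?case
    unfolding beval.simps Let_def
    by (intro recursive_intros Minim w total_recursive_compose2[OF Minim.prems(1)]) auto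
qed

section \<open>Names of clopen sets and of open sets\<close>

definition agree :: "nat \<Rightarrow> baire \<Rightarrow> baire \<Rightarrow> bool" where
  "agree k p p' \<longleftrightarrow> (\<forall>i<k. p i = p' i)"

lemma agree_refl [simp]: "agree k p p"
  by (simp add: agree_def)

lemma agree_sym: "agree k p p' \<Longrightarrow> agree k p' p"
  by (simp add: agree_def)

lemma agree_mono: "agree k p p' \<Longrightarrow> j \<le> k \<Longrightarrow> agree j p p'"
  by (simp add: agree_def)

lemma agree_seq_nth_init_code: "agree k (seq_nth (init_code p k)) p"
  by (simp add: agree_def seq_nth_init_code)

lemma prefix_code_agree: "agree k p p' \<Longrightarrow> prefix_code n p k = prefix_code n p' k"
  unfolding agree_def by (rule prefix_code_cong) simp

text \<open>
The topology of Baire space enters the construction only through this criterion.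
\<close>

lemma open_locally_determined:
  assumes "\<And>p. p \<in> U \<Longrightarrow> \<exists>k. \<forall>p'. agree k p p' \<longrightarrow> p' \<in> U"
  shows "open (U :: baire set)"
proof (subst openin_subopen[of "euclidean", simplified], intro ballI)
  fix p assume "p \<in> U"
  then obtain k where k: "\<forall>p'. agree k p p' \<longrightarrow> p' \<in> U" using assms by blast
  let ?T = "Pi\<^sub>E UNIV (\<lambda>i. if i < k then {p i} else UNIV)"
  have "open ?T"
    by (rule open_PiE) (auto simp: open_discrete intro: finite_subset[of _ "{..<k}"] split: if_splits)
  moreover have "p \<in> ?T" by auto
  moreover have "?T \<subseteq> U"
  proof
    fix p' assume "p' \<in> ?T"
    then have "p' i \<in> (if i < k then {p i} else UNIV)" for i by (simp add: PiE_iff)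
    then have "p' i = p i" if "i < k" for i using that by (metis singletonD)
    then show "p' \<in> U" using k by (simp add: agree_def)
  qed
  ultimately show "\<exists>T. open T \<and> p \<in> T \<and> T \<subseteq> U" by blast
qed

definition decides :: "baire \<Rightarrow> nat \<Rightarrow> baire \<Rightarrow> nat \<Rightarrow> bool" where
  "decides q n p k \<longleftrightarrow> q (prefix_code n p k) \<noteq> 0 \<and> (\<forall>j<k. q (prefix_code n p j) = 0)"

lemma ex_decides_iff: "(\<exists>k. decides q n p k) \<longleftrightarrow> (\<exists>k. q (prefix_code n p k) \<noteq> 0)"
proof
  assume ex: "\<exists>k. q (prefix_code n p k) \<noteq> 0"
  define k where "k = (LEAST k. q (prefix_code n p k) \<noteq> 0)"
  have "q (prefix_code n p k) \<noteq> 0" unfolding k_def using ex by (rule LeastI_ex)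
  moreover have "\<forall>j<k. q (prefix_code n p j) = 0" unfolding k_def using not_less_Least by blast
  ultimately show "\<exists>k. decides q n p k" unfolding decides_def by blast
qed (auto simp: decides_def)

lemma decides_unique: "decides q n p k \<Longrightarrow> decides q n p l \<Longrightarrow> k = l"
  unfolding decides_def by (metis linorder_neqE_nat)

lemma encodes_on_iff_decides:
  "encodes_on D q F \<longleftrightarrow> (\<forall>p\<in>D. \<forall>n. \<exists>k. decides q n p k \<and> q (prefix_code n p k) = Suc (F p n))"
  unfolding encodes_on_def decides_def by (intro ball_cong refl iff_allI iff_exI) auto

lemma decides_agree: "agree k p p' \<Longrightarrow> decides q n p k \<Longrightarrow> decides q n p' k"
proof -
  assume p: "agree k p p'" and d: "decides q n p k"
  have "prefix_code n p j = prefix_code n p' j" if "j \<le> k" for j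
    by (rule prefix_code_agree[OF agree_mono[OF p that]])
  then show ?thesis using d unfolding decides_def by simp
qed

lemma decides_agree_value:
  "agree k p p' \<Longrightarrow> decides q n p k \<Longrightarrow> q (prefix_code n p' k) = q (prefix_code n p k)"
  using prefix_code_agree by simp

text \<open>
This makes the continuity requirement in the definition of a name redundant, and reduces the
properties of being a name to conditions on \<^const>\<open>decides\<close>.
\<close>

lemma encodes_on_imp_continuous_on:
  assumes "encodes_on D q F"
  shows "continuous_on D F"
proof (rule continuous_on_coordinatewise_then_product)
  fix n
  show "continuous_on D (\<lambda>p. F p n)"
    unfolding continuous_on_open_invariant
  proof (intro allI impI)
    fix B :: "nat set"
    define U where "U = {p. \<exists>k. decides q n p k \<and> q (prefix_code n p k) - 1 \<in> B}"
    have "open U"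
    proof (rule open_locally_determined)
      fix p assume "p \<in> U"
      then obtain k where "decides q n p k" "q (prefix_code n p k) - 1 \<in> B" unfolding U_def by blast
      then have "\<forall>p'. agree k p p' \<longrightarrow> decides q n p' k \<and> q (prefix_code n p' k) - 1 \<in> B"
        by (simp add: decides_agree decides_agree_value)
      then show "\<exists>k. \<forall>p'. agree k p p' \<longrightarrow> p' \<in> U" unfolding U_def by blast
    qed
    moreover have "U \<inter> D = (\<lambda>p. F p n) -` B \<inter> D"
    proof -
      have "p \<in> U \<longleftrightarrow> F p n \<in> B" if p: "p \<in> D" for p
      proof -
        obtain k where k: "decides q n p k" "q (prefix_code n p k) = Suc (F p n)"
          using assms p unfolding encodes_on_iff_decides by blast
        then have "p \<in> U \<longleftrightarrow> q (prefix_code n p k) - 1 \<in> B"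
          unfolding U_def using decides_unique[OF k(1)] by blast
        then show ?thesis using k(2) by simp
      qed
      then show ?thesis by blast
    qed
    ultimately show "\<exists>A. open A \<and> A \<inter> D = (\<lambda>p. F p n) -` B \<inter> D" by blast
  qed
qed

abbreviation clopens :: "(baire \<Rightarrow> nat) represented" where
  "clopens \<equiv> fun_space baire_space two_space"

lemma dom_baire_space [simp]: "dom baire_space = UNIV"
  and carrier_baire_space [simp]: "carrier baire_space = UNIV"
  by (auto simp: baire_space_def ran_def)

lemma two_space_eq_Some: "two_space p = Some v \<longleftrightarrow> p 0 = v \<and> v \<le> 1"
  by (auto simp: two_space_def subspace_of_def nat_space_def)

lemma decides_imp_encodes_on:
  assumes "\<forall>n p. \<exists>k. decides q n p k"
  shows "\<exists>F. encodes_on UNIV q F"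
proof -
  have "\<forall>p n. \<exists>v k. decides q n p k \<and> q (prefix_code n p k) = Suc v"
    using assms unfolding decides_def by (meson not0_implies_Suc)
  then obtain F where "\<forall>p n. \<exists>k. decides q n p k \<and> q (prefix_code n p k) = Suc (F p n)"
    by metis
  then show ?thesis unfolding encodes_on_iff_decides by blast
qed

text \<open>
Only the component 0 of the realizer carries information, but all components must be defined.
\<close>

lemma clopens_eq_Some_iff:
  "clopens q = Some x \<longleftrightarrow> (\<forall>n p. \<exists>k. decides q n p k) \<and>
     (\<forall>p k. decides q 0 p k \<longrightarrow> q (prefix_code 0 p k) = Suc (x p) \<and> x p \<le> 1)"
proof
  assume "clopens q = Some x"
  then obtain F where F: "realizes baire_space two_space F x" "encodes_on UNIV q F"
    unfolding fun_space_eq_Some names_fun_def by auto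
  have x: "x p = F p 0" "x p \<le> 1" for p
    using F(1) by (auto simp: realizes_def baire_space_def two_space_eq_Some)
  have "q (prefix_code 0 p k) = Suc (x p)" if "decides q 0 p k" for p k
  proof -
    obtain l where "decides q 0 p l" "q (prefix_code 0 p l) = Suc (F p 0)"
      using F(2) unfolding encodes_on_iff_decides by blast
    then show ?thesis using decides_unique[OF that] x(1) by simp
  qed
  moreover have "\<exists>k. decides q n p k" for n p
    using F(2) unfolding encodes_on_iff_decides by blast
  ultimately show "(\<forall>n p. \<exists>k. decides q n p k) \<and>
     (\<forall>p k. decides q 0 p k \<longrightarrow> q (prefix_code 0 p k) = Suc (x p) \<and> x p \<le> 1)"
    using x(2) by simp
next
  assume q: "(\<forall>n p. \<exists>k. decides q n p k) \<and>
     (\<forall>p k. decides q 0 p k \<longrightarrow> q (prefix_code 0 p k) = Suc (x p) \<and> x p \<le> 1)"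
  then obtain F where enc: "encodes_on UNIV q F" using decides_imp_encodes_on by blast
  have "realizes baire_space two_space F x"
    unfolding realizes_def
  proof (intro allI impI)
    fix p y assume "baire_space p = Some y"
    then have "y = p" by (simp add: baire_space_def)
    moreover obtain k where "decides q 0 p k" "q (prefix_code 0 p k) = Suc (F p 0)"
      using enc unfolding encodes_on_iff_decides by blast
    moreover have "q (prefix_code 0 p k) = Suc (x p)" "x p \<le> 1"
      using q calculation(2) by blast+
    ultimately show "two_space (F p) = Some (x y)"
      by (simp add: two_space_eq_Some)
  qed
  then show "clopens q = Some x"
    unfolding fun_space_eq_Some names_fun_def
    using enc encodes_on_imp_continuous_on[OF enc] by auto
qed

lemma dom_fun_space_nat_iff:
  "y \<in> dom (fun_space baire_space nat_space) \<longleftrightarrow> (\<forall>n p. \<exists>k. decides y n p k)"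
proof
  assume "y \<in> dom (fun_space baire_space nat_space)"
  then obtain f where "names_fun baire_space nat_space y f" by (auto simp: fun_space_eq_Some)
  then show "\<forall>n p. \<exists>k. decides y n p k"
    unfolding names_fun_def encodes_on_iff_decides by auto
next
  assume y: "\<forall>n p. \<exists>k. decides y n p k"
  then obtain F where enc: "encodes_on UNIV y F" using decides_imp_encodes_on by blast
  moreover have "realizes baire_space nat_space F (\<lambda>p. F p 0)"
    by (simp add: realizes_def baire_space_def nat_space_def)
  ultimately have "names_fun baire_space nat_space y (\<lambda>p. F p 0)"
    unfolding names_fun_def using encodes_on_imp_continuous_on[OF enc] by auto
  then show "y \<in> dom (fun_space baire_space nat_space)"
    using fun_space_eq_Some by blast
qed

definition accepts :: "baire \<Rightarrow> baire \<Rightarrow> bool" where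
  "accepts b q \<longleftrightarrow> (\<exists>n k. decides b n q k \<and> 2 \<le> b (prefix_code n q k))"

lemma accepts_locally_determined:
  assumes "accepts b q" shows "\<exists>k. \<forall>q'. agree k q q' \<longrightarrow> accepts b q'"
proof -
  obtain n k where "decides b n q k" "2 \<le> b (prefix_code n q k)"
    using assms unfolding accepts_def by blast
  then have "\<forall>q'. agree k q q' \<longrightarrow> decides b n q' k \<and> 2 \<le> b (prefix_code n q' k)"
    by (simp add: decides_agree decides_agree_value)
  then show ?thesis unfolding accepts_def by blast
qed

lemma open_space_value:
  assumes "open_space X b = Some u" "X q = Some x"
  shows "u x = Top \<longleftrightarrow> accepts b q"
proof -
  obtain F where F: "realizes X sierpinski_space F u" "encodes_on (dom X) b F"
    using assms(1) unfolding open_space_def fun_space_eq_Some names_fun_def by auto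
  have "u x = Top \<longleftrightarrow> F q \<noteq> (\<lambda>_. 0)"
    using F(1) assms(2) by (auto simp: realizes_def sierpinski_space_def split: if_splits)
  also have "\<dots> \<longleftrightarrow> (\<exists>n. F q n \<noteq> 0)" by auto
  also have "\<dots> \<longleftrightarrow> accepts b q"
  proof -
    have "F q n \<noteq> 0 \<longleftrightarrow> (\<exists>k. decides b n q k \<and> 2 \<le> b (prefix_code n q k))" for n
    proof -
      have "q \<in> dom X" using assms(2) by blast
      then obtain k where k: "decides b n q k" "b (prefix_code n q k) = Suc (F q n)"
        using F(2) unfolding encodes_on_iff_decides by blast
      then have "(\<exists>k. decides b n q k \<and> 2 \<le> b (prefix_code n q k)) \<longleftrightarrow> 2 \<le> b (prefix_code n q k)"
        using decides_unique[OF k(1)] by blast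
      then show ?thesis using k(2) by (simp add: Suc_le_eq)
    qed
    then show ?thesis unfolding accepts_def by blast
  qed
  finally show ?thesis .
qed

text \<open>
The associate of the realizer whose value at \<open>n\<close> tells whether \<open>E\<close> holds at stage \<open>n\<close>. It answers
question \<open>n\<close> after reading exactly \<open>n\<close> values of the argument, which suffices when stage \<open>n\<close> of \<open>E\<close>
looks at no more than that.
\<close>

definition semidecision_name :: "(baire \<Rightarrow> nat \<Rightarrow> bool) \<Rightarrow> baire" where
  "semidecision_name E c =
     (if seq_len c - 1 < seq_nth c 0 then 0 else Suc (of_bool (E (\<lambda>i. seq_nth c (Suc i)) (seq_nth c 0))))"

lemma seq_nth_prefix_code_0 [simp]: "seq_nth (prefix_code n p k) 0 = n"
  by (simp add: prefix_code_init_code)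

lemma seq_nth_prefix_code_Suc [simp]: "seq_nth (prefix_code n p k) (Suc i) = (if i < k then p i else 0)"
  by (simp add: prefix_code_def seq_nth_list_encode del: list_encode.simps)

lemma seq_len_prefix_code [simp]: "seq_len (prefix_code n p k) = Suc k"
  by (simp add: prefix_code_def del: list_encode.simps)

lemma open_space_semidecision_name:
  assumes local: "\<And>l q q'. agree l q q' \<Longrightarrow> E q l = E q' l"
    and W: "\<And>q x. X q = Some x \<Longrightarrow> x \<in> W \<longleftrightarrow> (\<exists>l. E q l)"
  shows "open_space X (semidecision_name E) =
    Some (restrict (\<lambda>x. if x \<in> W then Top else Bot) (carrier X))"
proof -
  define F :: "baire \<Rightarrow> baire" where "F q n = of_bool (E q n)" for q n
  have *: "semidecision_name E (prefix_code n q k) = (if k < n then 0 else Suc (F q n))" for n q k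
  proof -
    have "agree n (\<lambda>i. if i < k then q i else 0) q" if "\<not> k < n"
      using that by (auto simp: agree_def)
    then show ?thesis unfolding semidecision_name_def F_def using local by auto
  qed
  have enc: "encodes_on (dom X) (semidecision_name E) F"
    unfolding encodes_on_def
  proof (intro ballI allI)
    fix q n
    show "\<exists>k. semidecision_name E (prefix_code n q k) = Suc (F q n) \<and>
        (\<forall>j<k. semidecision_name E (prefix_code n q j) = 0)"
      by (rule exI[of _ n]) (simp add: *)
  qed
  have "realizes X sierpinski_space F (restrict (\<lambda>x. if x \<in> W then Top else Bot) (carrier X))"
    unfolding realizes_def
  proof (intro allI impI)
    fix q x assume qx: "X q = Some x"
    have "F q = (\<lambda>_. 0) \<longleftrightarrow> x \<notin> W"
      unfolding W[OF qx] F_def by (auto simp: fun_eq_iff)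
    moreover have "x \<in> carrier X" using qx by (auto simp: ran_def)
    ultimately show "sierpinski_space (F q) =
        Some (restrict (\<lambda>x. if x \<in> W then Top else Bot) (carrier X) x)"
      by (simp add: sierpinski_space_def)
  qed
  then show ?thesis
    unfolding open_space_def fun_space_eq_Some names_fun_def
    using enc encodes_on_imp_continuous_on[OF enc] by auto
qed

lemma total_recursive_semidecision_name:
  assumes "\<And>q l. total_recursive (\<lambda>e. q (pfst e) (psnd e)) \<Longrightarrow> total_recursive l \<Longrightarrow>
     decidable (\<lambda>x. E (\<lambda>i. q i x) (l x))"
  shows "total_recursive (semidecision_name E)"
  unfolding semidecision_name_def[abs_def]
  by (intro recursive_intros assms)

lemma total_recursive_imp_computable_point: "total_recursive f \<Longrightarrow> computable_point f"
  unfolding total_recursive_def computable_point_def by blast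

lemma decidable_decides [recursive_intros]:
  assumes "total_recursive (\<lambda>e. q (pfst e) (psnd e))" "total_recursive n"
    "total_recursive (\<lambda>e. p (pfst e) (psnd e))" "total_recursive k"
  shows "decidable (\<lambda>x. decides (\<lambda>i. q i x) (n x) (\<lambda>i. p i x) (k x))"
  unfolding decides_def
  by (intro recursive_intros assms total_recursive_compose2[OF assms(1)]
      total_recursive_compose2[OF assms(3)] total_recursive_compose[OF assms(2)])

section \<open>Points carrying well-founded codes\<close>

definition section_of :: "baire \<Rightarrow> nat \<Rightarrow> baire" where
  "section_of r s t = r (prod_encode (s, t))"

text \<open>
For fixed \<open>r\<close>, the finite sequences on which no initial segment passes the test \<open>\<tau>\<close> form a tree; \<open>\<tau> r p k\<close> says
that \<open>p\<close> is found to have left it after \<open>k\<close> steps.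
\<close>

locale exit_test =
  fixes \<tau> :: "baire \<Rightarrow> baire \<Rightarrow> nat \<Rightarrow> bool"
  assumes exit_local: "agree k r r' \<Longrightarrow> agree k p p' \<Longrightarrow> \<tau> r p k = \<tau> r' p' k"
begin

definition wellfounded_codes :: "baire set" where
  "wellfounded_codes = {r. \<forall>p. \<exists>k. \<tau> r p k}"

text \<open>
The search is cut off at \<open>k\<close>, so that the value \<open>k\<close> means that \<open>p\<close> stays in the tree before step \<open>k\<close>.
\<close>

definition exit_time :: "baire \<Rightarrow> baire \<Rightarrow> nat \<Rightarrow> nat" where
  "exit_time r p k = (LEAST i. \<tau> r p i \<or> k \<le> i)"

text \<open>
What is known about the value at \<open>p\<close> of the clopen set \<open>point r n d m\<close> from the first \<open>k\<close> values of
\<open>p\<close>: 0 means nothing, \<open>Suc v\<close> means that the value is \<open>v\<close>. The first entry of \<open>p\<close> selects one of five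
components:
  \<^item> component 0 carries the digits of \<open>r\<close>: with the digit position in the next entry, the value is the
    parity of entry number \<open>r j\<close> of the rest;
  \<^item> component 1 carries the exit times: the remaining entries are pairs, the first halves are a path
    through the tree, and the value is the parity of the second half at the exit time;
  \<^item> component 2 is the set of all sequences starting with \<open>n - 1\<close>, or empty for \<open>n = 0\<close>;
  \<^item> component 3 is the set of all sequences with entry \<open>m - 1\<close> at position \<open>d\<close>, or empty for \<open>m = 0\<close>;
  \<^item> all other components are empty.
Thus \<open>(n, d, m) = (0, 0, 0)\<close> gives the limit \<open>x\<^sub>r\<close> of Arens' space, \<open>(n, d, 0)\<close> with \<open>n > 0\<close> gives the
points converging to it, and \<open>(n, n, Suc m)\<close> gives the isolated points. The parameter \<open>d\<close> also delays
the answer in component 3 when the set is empty. This affects only the name of the point: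
with delay 0 the names of \<open>x\<^sub>r\<^sub>,\<^sub>n\<close> approach that of \<open>x\<^sub>r\<close>, with delay \<open>n\<close> they are limits of the names of
\<open>x\<^sub>r\<^sub>,\<^sub>n\<^sub>,\<^sub>m\<close>.
\<close>

definition reading :: "baire \<Rightarrow> nat \<Rightarrow> nat \<Rightarrow> nat \<Rightarrow> baire \<Rightarrow> nat \<Rightarrow> nat" where
  "reading r n d m p k =
     (if k = 0 then 0
      else if p 0 = 0 then
        (if r (p 1) + 2 < k then Suc (p (r (p 1) + 2) mod 2) else 0)
      else if p 0 = 1 then
        (if Suc (exit_time r (\<lambda>j. pfst (p (Suc j))) (k - 1)) < k
         then Suc (psnd (p (Suc (exit_time r (\<lambda>j. pfst (p (Suc j))) (k - 1)))) mod 2) else 0)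
      else if p 0 = 2 then (if 1 < k then Suc (of_bool (Suc (p 1) = n)) else 0)
      else if p 0 = 3 then (if Suc d < k then Suc (of_bool (Suc (p (Suc d)) = m)) else 0)
      else 1)"

definition point :: "baire \<Rightarrow> nat \<Rightarrow> nat \<Rightarrow> nat \<Rightarrow> baire \<Rightarrow> nat" where
  "point r n d m p = reading r n d m p (LEAST k. reading r n d m p k \<noteq> 0) - 1"

definition name_of_point :: "baire \<Rightarrow> nat \<Rightarrow> nat \<Rightarrow> nat \<Rightarrow> baire" where
  "name_of_point r n d m c = reading r n d m (\<lambda>i. seq_nth c (Suc i)) (seq_len c - 1)"

subsection \<open>Readings\<close>

lemma exit_time_le: "exit_time r p k \<le> k"
  unfolding exit_time_def by (rule Least_le) simp

lemma exit_time_less: "exit_time r p k < k \<Longrightarrow> \<tau> r p (exit_time r p k)"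
  using LeastI[of "\<lambda>i. \<tau> r p i \<or> k \<le> i" k] unfolding exit_time_def by auto

lemma exit_time_eqI: "\<tau> r p i \<Longrightarrow> i < k \<Longrightarrow> (\<And>j. j < i \<Longrightarrow> \<not> \<tau> r p j) \<Longrightarrow> exit_time r p k = i"
  unfolding exit_time_def by (rule Least_equality) (auto simp: not_le[symmetric])

lemma not_exit_before: "j < exit_time r p k \<Longrightarrow> \<not> \<tau> r p j"
  unfolding exit_time_def using not_less_Least by blast

lemma exit_time_mono:
  assumes "exit_time r p k < k" "k \<le> k'" shows "exit_time r p k' = exit_time r p k"
  by (rule exit_time_eqI) (use assms exit_time_less not_exit_before in auto)

lemma exit_time_agree:
  assumes "agree k r r'" "agree k p p'" shows "exit_time r p k = exit_time r' p' k"
proof -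
  have "\<tau> r p i \<or> k \<le> i \<longleftrightarrow> \<tau> r' p' i \<or> k \<le> i" for i
    using exit_local[of i r r' p p'] agree_mono[OF assms(1), of i] agree_mono[OF assms(2), of i]
    by (cases "k \<le> i") auto
  then show ?thesis unfolding exit_time_def by simp
qed

text \<open>
Component 0 reads \<open>r\<close> at the position given by an entry of \<open>p\<close>, component 1 reads fewer than \<open>k\<close>
values of \<open>r\<close>; the others do not read \<open>r\<close>.
\<close>

lemma reading_agree:
  assumes p: "agree k p p'" and r: "agree l r r'" and "k \<le> l" "1 < k \<Longrightarrow> p 1 < l"
  shows "reading r n d m p k = reading r' n d m p' k"
proof (cases "k = 0")
  case False
  have p_eq: "p' i = p i" if "i < k" for i using p that by (simp add: agree_def)
  have r_eq: "r' i = r i" if "i < l" for i using r that by (simp add: agree_def)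
  have 0: "p' 0 = p 0" using False by (simp add: p_eq)
  consider "p 0 = 0" | "p 0 = 1" | "p 0 = 2" | "p 0 = 3" | "p 0 > 3" by linarith
  then show ?thesis
  proof cases
    case 1
    show ?thesis
    proof (cases "1 < k")
      case True
      then have "p' 1 = p 1" "r' (p 1) = r (p 1)" using p_eq r_eq assms(4) by auto
      then show ?thesis unfolding reading_def using 1 0 p_eq[of "r (p 1) + 2"] by auto
    qed (use 1 0 in \<open>auto simp: reading_def\<close>)
  next
    case 2
    have "exit_time r (\<lambda>j. pfst (p (Suc j))) (k - 1) = exit_time r' (\<lambda>j. pfst (p' (Suc j))) (k - 1)"
      by (rule exit_time_agree) (use r assms(3) p_eq in \<open>auto simp: agree_def\<close>)
    then show ?thesis using 2 0 p_eq unfolding reading_def by auto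
  qed (use 0 p_eq in \<open>auto simp: reading_def\<close>)
qed (simp add: reading_def)

lemma reading_mono:
  assumes "reading r n d m p k \<noteq> 0" "k \<le> k'"
  shows "reading r n d m p k' = reading r n d m p k"
proof (cases "p 0 = 1")
  case True
  then have "Suc (exit_time r (\<lambda>j. pfst (p (Suc j))) (k - 1)) < k"
    using assms(1) by (auto simp: reading_def split: if_splits)
  then have "exit_time r (\<lambda>j. pfst (p (Suc j))) (k' - 1) = exit_time r (\<lambda>j. pfst (p (Suc j))) (k - 1)"
    by (intro exit_time_mono) (use assms(2) in auto)
  then show ?thesis using assms True by (auto simp: reading_def split: if_splits)
qed (use assms in \<open>auto simp: reading_def split: if_splits\<close>)

lemma ex_reading:
  assumes "r \<in> wellfounded_codes" shows "\<exists>k. reading r n d m p k \<noteq> 0"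
proof -
  consider "p 0 = 0" | "p 0 = 1" | "p 0 = 2" | "p 0 = 3" | "p 0 > 3" by linarith
  then show ?thesis
  proof cases
    case 1
    then show ?thesis by (intro exI[of _ "r (p 1) + 3"]) (simp add: reading_def)
  next
    case 2
    obtain k where k: "\<tau> r (\<lambda>j. pfst (p (Suc j))) k"
      using assms unfolding wellfounded_codes_def by blast
    have "exit_time r (\<lambda>j. pfst (p (Suc j))) (Suc k) \<le> k"
      unfolding exit_time_def by (rule Least_le) (simp add: k)
    then show ?thesis using 2 by (intro exI[of _ "Suc (Suc k)"]) (simp add: reading_def)
  next
    case 3
    then show ?thesis by (intro exI[of _ 2]) (simp add: reading_def)
  next
    case 4
    then show ?thesis by (intro exI[of _ "Suc (Suc d)"]) (simp add: reading_def)
  next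
    case 5
    then show ?thesis by (intro exI[of _ 1]) (simp add: reading_def)
  qed
qed

lemma reading_le_2: "reading r n d m p k \<le> 2"
  by (auto simp: reading_def)

lemma reading_eq_point:
  assumes "reading r n d m p k \<noteq> 0" shows "reading r n d m p k = Suc (point r n d m p)"
proof -
  define l where "l = (LEAST k. reading r n d m p k \<noteq> 0)"
  have l: "reading r n d m p l \<noteq> 0" unfolding l_def using assms by (rule LeastI)
  have "l \<le> k" unfolding l_def using assms by (rule Least_le)
  then have "reading r n d m p k = reading r n d m p l" by (rule reading_mono[OF l])
  moreover have "point r n d m p = reading r n d m p l - 1" by (simp only: point_def l_def)
  ultimately show ?thesis using l by simp
qed

text \<open>
Two names of the same point, which extensionality of open sets allows to exchange.
\<close>

lemma point_delayed:
  assumes "r \<in> wellfounded_codes" shows "point r n d 0 = point r n d' 0"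
proof
  fix p
  obtain k k' where k: "reading r n d 0 p k \<noteq> 0" and k': "reading r n d' 0 p k' \<noteq> 0"
    using ex_reading[OF assms] by metis
  define l where "l = max k k'"
  have l: "reading r n d 0 p l \<noteq> 0" "reading r n d' 0 p l \<noteq> 0"
    using reading_mono[OF k, of l] reading_mono[OF k', of l] k k' by (simp_all add: l_def)
  then have "reading r n d 0 p l = reading r n d' 0 p l"
    by (auto simp: reading_def split: if_splits)
  then show "point r n d 0 p = point r n d' 0 p"
    using reading_eq_point[OF l(1)] reading_eq_point[OF l(2)] by simp
qed

lemma name_of_point_prefix_code: "name_of_point r n d m (prefix_code i p k) = reading r n d m p k"
  unfolding name_of_point_def
  by (rule trans[OF reading_agree[of _ _ p "k + p 1 + 2" r r]]) (auto simp: agree_def)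

lemma clopens_name_of_point:
  assumes "r \<in> wellfounded_codes"
  shows "clopens (name_of_point r n d m) = Some (point r n d m)"
  unfolding clopens_eq_Some_iff ex_decides_iff name_of_point_prefix_code
proof (intro conjI allI impI)
  show "\<exists>k. reading r n d m p k \<noteq> 0" for p by (rule ex_reading[OF assms])
  fix p k assume "decides (name_of_point r n d m) 0 p k"
  then have k: "reading r n d m p k \<noteq> 0" by (simp add: decides_def name_of_point_prefix_code)
  show "reading r n d m p k = Suc (point r n d m p)" by (rule reading_eq_point[OF k])
  then show "point r n d m p \<le> 1" using reading_le_2[of r n d m p k] by simp
qed

text \<open>
A reading is as early as it can be: as long as it is undetermined, both values still occur on
the cylinder. So what a name of a removed point has committed itself to must agree with the reading
at the same stage, and not just in the limit. Positivity of \<open>n\<close> and \<open>m\<close> ensures that components 2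
and 3 are not constant.
\<close>

lemma reading_of_constant:
  assumes r: "r \<in> wellfounded_codes" and n: "0 < n" and m: "0 < m"
    and const: "\<And>p'. agree k p p' \<Longrightarrow> point r n d m p' = v"
  shows "reading r n d m p k = Suc v"
proof -
  have "reading r n d m p k \<noteq> 0"
  proof
    assume 0: "reading r n d m p k = 0"
    have "\<exists>p1 p2 k1 k2. agree k p p1 \<and> agree k p p2 \<and> reading r n d m p1 k1 = 1 \<and> reading r n d m p2 k2 = 2"
    proof (cases "k = 0")
      case True
      have "reading r n d m (\<lambda>_. 4) 1 = 1" by (simp add: reading_def)
      moreover have "reading r n d m (\<lambda>i. if i = 0 then 2 else n - 1) 2 = 2"
        using n by (simp add: reading_def)
      ultimately show ?thesis using True by (auto simp: agree_def)
    next
      case k: False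
      consider "p 0 = 0" "k \<le> r (p 1) + 2" | "p 0 = 1" | "p 0 = 2" "k = 1" | "p 0 = 3" "k \<le> Suc d"
        using 0 k by (auto simp: reading_def split: if_splits)
      then show ?thesis
      proof cases
        case 1
        show ?thesis
        proof (cases "k = 1")
          case True
          let ?p = "\<lambda>b i. if i = 0 then 0 else if i = 1 then 0 else b"
          have "reading r n d m (?p b) (r 0 + 3) = Suc b" if "b \<le> 1" for b
            using that by (auto simp: reading_def)
          then have "reading r n d m (?p 0) (r 0 + 3) = 1" "reading r n d m (?p 1) (r 0 + 3) = 2" by simp_all
          moreover have "agree k p (?p b)" for b using True 1 by (simp add: agree_def)
          ultimately show ?thesis by blast
        next
          case False
          let ?p = "\<lambda>b. p(r (p 1) + 2 := b)"
          have "reading r n d m (?p b) (r (p 1) + 3) = Suc b" if "b \<le> 1" for b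
            using that 1 by (auto simp: reading_def)
          then have "reading r n d m (?p 0) (r (p 1) + 3) = 1" "reading r n d m (?p 1) (r (p 1) + 3) = 2"
            by simp_all
          moreover have "agree k p (?p b)" for b using 1 by (simp add: agree_def)
          ultimately show ?thesis by blast
        qed
      next
        case 2
        \<comment> \<open>The path may never leave the tree within the cylinder, so it is extended by zeros and the
          second half of the pair at the exit time is varied.\<close>
        let ?e = "\<lambda>p k. exit_time r (\<lambda>j. pfst (p (Suc j))) k"
        define P :: "nat \<Rightarrow> baire" where "P b i = (if i < k then p i else prod_encode (0, b))" for b i
        have "reading r n d m p k = 0" by (rule 0)
        then have "?e p (k - 1) = k - 1"
          using 2 k exit_time_le[of r "\<lambda>j. pfst (p (Suc j))" "k - 1"]
          by (auto simp: reading_def split: if_splits)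
        moreover have same: "?e (P b) (k - 1) = ?e p (k - 1)" for b
          by (rule exit_time_agree) (auto simp: agree_def P_def)
        ultimately have late: "?e (P b) (k - 1) = k - 1" for b by simp
        obtain l where l: "reading r n d m (P 0) l \<noteq> 0" using ex_reading[OF r] by blast
        have p0: "P b 0 = 1" for b using 2 k by (simp add: P_def)
        have e: "Suc (?e (P 0) (l - 1)) < l"
          using l p0[of 0] unfolding reading_def by (auto split: if_splits)
        have late_exit: "k \<le> Suc (?e (P 0) (l - 1))"
        proof (rule ccontr)
          assume "\<not> ?thesis"
          then have "\<not> \<tau> r (\<lambda>j. pfst (P 0 (Suc j))) (?e (P 0) (l - 1))"
            using not_exit_before[of "?e (P 0) (l - 1)" r "\<lambda>j. pfst (P 0 (Suc j))" "k - 1"] late[of 0] by simp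
          moreover have "\<tau> r (\<lambda>j. pfst (P 0 (Suc j))) (?e (P 0) (l - 1))"
            by (rule exit_time_less) (use e in linarith)
          ultimately show False by blast
        qed
        have same: "(\<lambda>j. pfst (P b (Suc j))) = (\<lambda>j. pfst (P 0 (Suc j)))" for b
          by (auto simp: P_def)
        have same_exit: "?e (P b) (l - 1) = ?e (P 0) (l - 1)" for b unfolding same[of b] ..
        have "P b (Suc (?e (P 0) (l - 1))) = prod_encode (0, b)" for b
          using late_exit by (simp add: P_def)
        then have "reading r n d m (P b) l = Suc (b mod 2)" for b
          using e p0[of b] unfolding reading_def same_exit[of b] by simp
        then have "reading r n d m (P 0) l = 1" "reading r n d m (P 1) l = 2" by simp_all
        moreover have "agree k p (P b)" for b by (simp add: agree_def P_def)
        ultimately show ?thesis by blast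
      next
        case 3
        let ?p = "\<lambda>b i. if i = 0 then 2 else b"
        have "reading r n d m (?p (n - 1)) 2 = 2" "reading r n d m (?p n) 2 = 1"
          using n by (simp_all add: reading_def)
        moreover have "agree k p (?p b)" for b using 3 by (simp add: agree_def)
        ultimately show ?thesis by blast
      next
        case 4
        let ?p = "\<lambda>b. p(Suc d := b)"
        have "reading r n d m (?p (m - 1)) (d + 2) = 2" "reading r n d m (?p m) (d + 2) = 1"
          using m 4 by (simp_all add: reading_def)
        moreover have "agree k p (?p b)" for b using 4 by (simp add: agree_def)
        ultimately show ?thesis by blast
      qed
    qed
    then obtain p1 p2 k1 k2 where *: "agree k p p1" "agree k p p2"
      "reading r n d m p1 k1 = 1" "reading r n d m p2 k2 = 2" by blast
    have "reading r n d m p1 k1 = Suc v" "reading r n d m p2 k2 = Suc v"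
      using reading_eq_point[of r n d m p1 k1] reading_eq_point[of r n d m p2 k2] const * by simp_all
    then show False using * by simp
  qed
  then show ?thesis using reading_eq_point[of r n d m p k] const[of p] by simp
qed


subsection \<open>The removed points\<close>

lemma name_of_point_agree:
  assumes "agree l r r'" "c \<le> l" shows "name_of_point r n d m c = name_of_point r' n d m c"
proof (cases "c = 0")
  case True
  then show ?thesis using seq_nth_beyond[of 0] seq_len_le[of 0]
    by (simp add: name_of_point_def reading_def)
next
  case False
  show ?thesis unfolding name_of_point_def
  proof (rule reading_agree[OF agree_refl assms(1)])
    show "seq_len c - 1 \<le> l" using seq_len_le[of c] assms(2) by linarith
    assume "1 < seq_len c - 1"
    then have "seq_nth c (Suc 1) < c" by (intro seq_nth_less) linarith
    then show "seq_nth c (Suc 1) < l" using assms(2) by linarith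
  qed
qed

text \<open>
By stage \<open>l\<close>, one of the names coded in \<open>r\<close> is observed to accept the point. All positions of \<open>r\<close>
that are inspected lie below \<open>l\<close>.
\<close>

definition seen :: "baire \<Rightarrow> nat \<Rightarrow> nat \<Rightarrow> nat \<Rightarrow> nat \<Rightarrow> bool" where
  "seen r n d m l \<longleftrightarrow> (\<exists>i<l. \<exists>v<l. \<exists>k<l.
     prod_encode (2 * i, prefix_code v (name_of_point r n d m) k) < l \<and>
     2 \<le> r (prod_encode (2 * i, prefix_code v (name_of_point r n d m) k)) \<and>
     (\<forall>j<k. r (prod_encode (2 * i, prefix_code v (name_of_point r n d m) j)) = 0))"

lemma seen_mono: "seen r n d m l \<Longrightarrow> l \<le> l' \<Longrightarrow> seen r n d m l'"
  unfolding seen_def by (meson less_le_trans)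

lemma seen_agree_imp:
  assumes "agree l r r'" "seen r n d m l" shows "seen r' n d m l"
proof -
  let ?c = "\<lambda>r v k. prefix_code v (name_of_point r n d m) k"
  obtain i v k where *: "i < l" "v < l" "k < l" "prod_encode (2 * i, ?c r v k) < l"
    "2 \<le> r (prod_encode (2 * i, ?c r v k))" "\<forall>j<k. r (prod_encode (2 * i, ?c r v j)) = 0"
    using assms(2) unfolding seen_def by blast
  have c: "?c r' v j = ?c r v j" if "j \<le> k" for j
    by (rule prefix_code_cong) (use name_of_point_agree[OF assms(1)] that \<open>k < l\<close> in simp)
  have "r' (prod_encode (2 * i, ?c r v j)) = r (prod_encode (2 * i, ?c r v j))" if "j \<le> k" for j
  proof -
    have "prod_encode (2 * i, ?c r v j) \<le> prod_encode (2 * i, ?c r v k)"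
      by (intro prod_encode_mono prefix_code_mono that order_refl)
    then show ?thesis using assms(1) *(4) by (simp add: agree_def)
  qed
  then have "prod_encode (2 * i, ?c r' v k) < l \<and> 2 \<le> r' (prod_encode (2 * i, ?c r' v k)) \<and>
      (\<forall>j<k. r' (prod_encode (2 * i, ?c r' v j)) = 0)"
    using * c by simp
  then show ?thesis unfolding seen_def using *(1-3) by blast
qed

lemma seen_agree: "agree l r r' \<Longrightarrow> seen r n d m l = seen r' n d m l"
  using seen_agree_imp agree_sym by blast

lemma ex_seen_iff:
  "(\<exists>l. seen r n d m l) \<longleftrightarrow> (\<exists>i. accepts (section_of r (2 * i)) (name_of_point r n d m))"
proof
  let ?c = "\<lambda>v k. prefix_code v (name_of_point r n d m) k"
  assume "\<exists>i. accepts (section_of r (2 * i)) (name_of_point r n d m)"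
  then obtain i v k where *: "2 \<le> r (prod_encode (2 * i, ?c v k))"
      "\<forall>j<k. r (prod_encode (2 * i, ?c v j)) = 0"
    unfolding accepts_def decides_def section_of_def by blast
  define l where "l = Suc (i + v + k + prod_encode (2 * i, ?c v k))"
  have "seen r n d m l"
    unfolding seen_def by (rule exI[of _ i], simp add: l_def, rule exI[of _ v], simp,
      rule exI[of _ k]) (use * in simp)
  then show "\<exists>l. seen r n d m l" by blast
next
  assume "\<exists>l. seen r n d m l"
  then obtain i v k where "2 \<le> r (prod_encode (2 * i, prefix_code v (name_of_point r n d m) k))"
      "\<forall>j<k. r (prod_encode (2 * i, prefix_code v (name_of_point r n d m) j)) = 0"
    unfolding seen_def by blast
  then show "\<exists>i. accepts (section_of r (2 * i)) (name_of_point r n d m)"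
    unfolding accepts_def decides_def section_of_def by (metis not_numeral_le_zero)
qed

text \<open>
The number \<open>c\<close> codes \<open>n\<close>, \<open>m\<close> and the stage at which \<open>x\<^sub>r\<^sub>,\<^sub>n\<^sub>,\<^sub>m\<close> is seen. The first conjunct makes \<open>n\<close> at
least as large as the stage at which \<open>x\<^sub>r\<close> itself is seen; this is what makes the set of removed
points closed.
\<close>

definition certified :: "baire \<Rightarrow> nat \<Rightarrow> bool" where
  "certified r c \<longleftrightarrow> seen r 0 0 0 (pfst c) \<and>
     seen r (pfst c) (pfst c) (Suc (pfst (psnd c))) (psnd (psnd c))"

definition first_certified :: "baire \<Rightarrow> nat \<Rightarrow> bool" where
  "first_certified r c \<longleftrightarrow> certified r c \<and> (\<forall>c'<c. \<not> certified r c')"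

text \<open>
All stages that occur are bounded by \<open>c\<close>, so \<open>c\<close> also bounds the part of \<open>r\<close> that is read.
\<close>

lemma certified_agree: "agree l r r' \<Longrightarrow> c \<le> l \<Longrightarrow> certified r c = certified r' c"
  unfolding certified_def
  using seen_agree agree_mono[of l r r'] pfst_le[of c] psnd_le[of "psnd c"] psnd_le[of c]
  by (meson le_trans)

lemma first_certified_agree:
  assumes "agree l r r'" "c \<le> l" shows "first_certified r c = first_certified r' c"
  unfolding first_certified_def using certified_agree[OF assms(1)] assms(2) by auto

lemma first_certified_unique: "first_certified r c \<Longrightarrow> first_certified r c' \<Longrightarrow> c = c'"
  unfolding first_certified_def by (metis linorder_neqE_nat)

lemma ex_first_certified: "certified r c \<Longrightarrow> \<exists>c. first_certified r c"
  unfolding first_certified_def by (metis exists_least_iff)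

lemma certified_imp_pos: "certified r c \<Longrightarrow> 0 < pfst c"
  unfolding certified_def seen_def by (metis gr_implies_not0 neq0_conv)

abbreviation certified_point :: "baire \<Rightarrow> nat \<Rightarrow> baire \<Rightarrow> nat" where
  "certified_point r c \<equiv> point r (pfst c) (pfst c) (Suc (pfst (psnd c)))"

definition removed :: "(baire \<Rightarrow> nat) set" where
  "removed = {certified_point r c | r c. r \<in> wellfounded_codes \<and> first_certified r c}"

lemma point_determines_code:
  assumes "r \<in> wellfounded_codes" "r' \<in> wellfounded_codes"
    and eq: "point r n d m = point r' n' d' m'"
  shows "r = r'"
proof (rule ccontr)
  assume "r \<noteq> r'"
  then obtain j where j: "r j \<noteq> r' j" by blast
  define p where "p i = (if i = 1 then j else if i = r j + 2 then 1 else 0)" for i :: nat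
  have "reading r n d m p (r j + 3) = 2" "reading r' n' d' m' p (r' j + 3) = 1"
    using j by (simp_all add: reading_def p_def)
  then show False
    using reading_eq_point[of r n d m p "r j + 3"] reading_eq_point[of r' n' d' m' p "r' j + 3"] eq
    by simp
qed

text \<open>
A sequence starting with \<open>n - 1\<close> has a code of size at least \<open>n\<close>, so the set in component 2 looks
empty to small codes.
\<close>

lemma name_of_point_tendsto_marked:
  "agree n (name_of_point r 0 0 0) (name_of_point r n 0 0)"
  unfolding agree_def
proof (intro allI impI)
  fix c assume c: "c < n"
  have "Suc (seq_nth c 2) \<noteq> n \<or> c = 0" if "1 < seq_len c - 1"
    using seq_nth_less[of 2 c] that c by linarith
  then show "name_of_point r 0 0 0 c = name_of_point r n 0 0 c"
    using seq_len_le[of c] unfolding name_of_point_def reading_def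
    by (cases "c = 0") (auto simp: numeral_2_eq_2)
qed

lemma name_of_point_tendsto_delayed:
  "agree m (name_of_point r n d 0) (name_of_point r n d (Suc m))"
  unfolding agree_def
proof (intro allI impI)
  fix c assume c: "c < m"
  have "seq_nth c (Suc (Suc d)) \<noteq> m" using seq_nth_le[of c "Suc (Suc d)"] c by linarith
  then show "name_of_point r n d 0 c = name_of_point r n d (Suc m) c"
    unfolding name_of_point_def reading_def by auto
qed

end

text \<open>
From here on, the open set coded by \<open>r\<close> is the union of the open sets named by its even-numbered
sections; the odd-numbered ones are free for witnesses.
\<close>

locale coded_families = exit_test +
  assumes valid: "r \<in> wellfounded_codes \<Longrightarrow> section_of r (2 * i) \<in> dom (open_space clopens)"
begin

lemma accepts_extensional:
  assumes "r \<in> wellfounded_codes" "clopens q = Some x" "clopens q' = Some x"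
  shows "accepts (section_of r (2 * i)) q = accepts (section_of r (2 * i)) q'"
proof -
  obtain u where "open_space clopens (section_of r (2 * i)) = Some u" using valid[OF assms(1)] by blast
  then show ?thesis using open_space_value assms(2,3) by metis
qed

text \<open>
The two steps of Arens' space: a name accepting \<open>x\<^sub>r\<close> accepts \<open>x\<^sub>r\<^sub>,\<^sub>n\<close> for large \<open>n\<close>, by its undelayed
name; by extensionality it accepts the delayed name as well, and hence \<open>x\<^sub>r\<^sub>,\<^sub>n\<^sub>,\<^sub>m\<close> for large \<open>m\<close>.
\<close>

lemma seen_imp_certified:
  assumes r: "r \<in> wellfounded_codes" and seen: "seen r 0 0 0 l"
  shows "\<exists>c. first_certified r c"
proof -
  obtain i where "accepts (section_of r (2 * i)) (name_of_point r 0 0 0)" (is "accepts ?b _")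
    using seen ex_seen_iff by blast
  then obtain k where k: "\<And>q. agree k (name_of_point r 0 0 0) q \<Longrightarrow> accepts ?b q"
    using accepts_locally_determined by blast
  define n where "n = max k l"
  have "accepts ?b (name_of_point r n 0 0)"
    by (rule k, rule agree_mono[OF name_of_point_tendsto_marked]) (simp add: n_def)
  then have "accepts ?b (name_of_point r n n 0)"
    using accepts_extensional[OF r clopens_name_of_point[OF r, of n 0 0]]
      clopens_name_of_point[OF r, of n n 0] unfolding point_delayed[OF r, of n n 0] by blast
  then obtain m where "\<And>q. agree m (name_of_point r n n 0) q \<Longrightarrow> accepts ?b q"
    using accepts_locally_determined by blast
  then have "accepts ?b (name_of_point r n n (Suc m))" using name_of_point_tendsto_delayed by blast
  then obtain l' where "seen r n n (Suc m) l'" using ex_seen_iff by blast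
  moreover have "seen r 0 0 0 n" using seen_mono[OF seen] by (simp add: n_def)
  ultimately have "certified r (prod_encode (n, prod_encode (m, l')))" by (simp add: certified_def)
  then show ?thesis by (rule ex_first_certified)
qed

text \<open>
The witness is \<open>x\<^sub>r\<close> if it is not in the open set coded by \<open>r\<close>, and the point removed for \<open>r\<close> otherwise.
\<close>

theorem diagonal:
  assumes r: "r \<in> wellfounded_codes"
  shows "\<exists>q x. clopens q = Some x \<and>
    (x \<in> removed \<longleftrightarrow> (\<exists>i. accepts (section_of r (2 * i)) q))"
proof (cases "\<exists>i. accepts (section_of r (2 * i)) (name_of_point r 0 0 0)")
  case False
  have "point r 0 0 0 \<notin> removed"
  proof
    assume "point r 0 0 0 \<in> removed"
    then obtain r' c where r': "r' \<in> wellfounded_codes" "first_certified r' c"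
      "point r 0 0 0 = certified_point r' c" unfolding removed_def by blast
    then have "r = r'" using point_determines_code[OF r] by blast
    then have "seen r 0 0 0 (pfst c)" using r'(2) by (simp add: first_certified_def certified_def)
    then show False using False ex_seen_iff by blast
  qed
  then show ?thesis using False clopens_name_of_point[OF r] by blast
next
  case True
  then obtain c where c: "first_certified r c" using ex_seen_iff seen_imp_certified[OF r] by blast
  then have "\<exists>i. accepts (section_of r (2 * i)) (name_of_point r (pfst c) (pfst c) (Suc (pfst (psnd c))))"
    unfolding first_certified_def certified_def using ex_seen_iff by blast
  moreover have "certified_point r c \<in> removed" unfolding removed_def using r c by blast
  ultimately show ?thesis using clopens_name_of_point[OF r] by blast
qed

subsection \<open>Evidence against removal\<close>

text \<open>
The cylinder coded by \<open>w\<close> is one on which the first \<open>l\<close> values of the name \<open>q\<close> fix the clopen set; it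
is the shortest such cylinder on its branch.
\<close>

definition constraint :: "baire \<Rightarrow> nat \<Rightarrow> nat \<Rightarrow> bool" where
  "constraint q l w \<longleftrightarrow> prefix_code 0 (seq_nth w) (seq_len w) < l \<and> decides q 0 (seq_nth w) (seq_len w)"

text \<open>
One more than the value on the cylinder, for comparison with readings.
\<close>

definition forced :: "baire \<Rightarrow> nat \<Rightarrow> nat" where
  "forced q w = q (prefix_code 0 (seq_nth w) (seq_len w))"

definition read_code :: "baire \<Rightarrow> nat \<Rightarrow> nat \<Rightarrow> nat \<Rightarrow> nat \<Rightarrow> nat" where
  "read_code r n d m w = reading r n d m (seq_nth w) (seq_len w)"

text \<open>
Satisfied also by the sequences too short to mention a digit; a constraint on such a cylinder
contradicts every candidate for every digit.
\<close>

definition about_digit :: "nat \<Rightarrow> nat \<Rightarrow> bool" where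
  "about_digit j w \<longleftrightarrow> seq_nth w 0 = 0 \<and> (seq_len w \<le> 1 \<or> seq_nth w 1 = j)"

definition refutes_digit :: "baire \<Rightarrow> nat \<Rightarrow> nat \<Rightarrow> nat \<Rightarrow> bool" where
  "refutes_digit q w j a \<longleftrightarrow> about_digit j w \<and>
     \<not> (a + 2 < seq_len w \<and> forced q w = Suc (seq_nth w (a + 2) mod 2))"

text \<open>
If \<open>q\<close> names a point carrying a code, then that code begins with the sequence coded by \<open>s\<close>. Candidates
\<open>a \<ge> seq_len w\<close> need no test: the constraint \<open>w\<close> itself excludes them.
\<close>

definition digits_determined :: "baire \<Rightarrow> nat \<Rightarrow> nat \<Rightarrow> bool" where
  "digits_determined q l s \<longleftrightarrow> (\<forall>j<seq_len s. \<exists>w<l. constraint q l w \<and> about_digit j w \<and>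
     (\<forall>a<seq_len w. a \<noteq> seq_nth s j \<longrightarrow> (\<exists>w'<l. constraint q l w' \<and> refutes_digit q w' j a)))"

text \<open>
The constraint \<open>w\<close> cannot hold for the point removed for \<open>r\<close>. The three clauses concern the
components carrying \<open>r\<close> and its exit times; component 3 before \<open>x\<^sub>r\<close> has been seen, when the removed
point has a larger \<open>n\<close> than the length of the cylinder; and all components once the removed point
has been found.
\<close>

definition clashes :: "baire \<Rightarrow> nat \<Rightarrow> baire \<Rightarrow> nat \<Rightarrow> bool" where
  "clashes q w r k \<longleftrightarrow>
     seq_nth w 0 \<noteq> 2 \<and> seq_nth w 0 \<noteq> 3 \<and> read_code r 0 0 0 w \<noteq> forced q w \<or>
     seq_nth w 0 = 3 \<and> \<not> seen r 0 0 0 (seq_len w) \<or>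
     (\<exists>c<Suc k. first_certified r c \<and>
        read_code r (pfst c) (pfst c) (Suc (pfst (psnd c))) w \<noteq> forced q w)"

definition contradicts :: "baire \<Rightarrow> nat \<Rightarrow> nat \<Rightarrow> bool" where
  "contradicts q l s \<longleftrightarrow> (\<exists>w<l. constraint q l w \<and> w \<le> seq_len s \<and> clashes q w (seq_nth s) (seq_len s))"

definition evidence :: "baire \<Rightarrow> nat \<Rightarrow> bool" where
  "evidence q l \<longleftrightarrow> (\<exists>s<l. digits_determined q l s \<and> contradicts q l s)"

lemma constraint_mono: "constraint q l w \<Longrightarrow> l \<le> l' \<Longrightarrow> constraint q l' w"
  by (auto simp: constraint_def)

lemma constraint_imp_less: "constraint q l w \<Longrightarrow> w < l"
  using le_prod_encode_2[of w 0] by (simp add: constraint_def prefix_code_init_code init_code_seq_nth_seq_len)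

lemma constraint_init_code:
  assumes "decides q 0 p k" "prefix_code 0 p k < l"
  shows "constraint q l (init_code p k)" "forced q (init_code p k) = q (prefix_code 0 p k)"
proof -
  have "agree k p (seq_nth (init_code p k))" by (rule agree_sym[OF agree_seq_nth_init_code])
  then show "constraint q l (init_code p k)" "forced q (init_code p k) = q (prefix_code 0 p k)"
    unfolding constraint_def forced_def
    using assms decides_agree[of k p "seq_nth (init_code p k)"] prefix_code_agree[of k p "seq_nth (init_code p k)"]
    by simp_all
qed

lemma read_code_init_code: "read_code r n d m (init_code p k) = reading r n d m p k"
  unfolding read_code_def seq_len_init_code
  by (rule reading_agree[of _ _ _ "k + seq_nth (init_code p k) 1 + 2"]) (auto intro: agree_seq_nth_init_code)

lemma constraint_forces:
  assumes "clopens q = Some x" "constraint q l w" "agree (seq_len w) (seq_nth w) p"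
  shows "x p = forced q w - 1"
proof -
  have "decides q 0 p (seq_len w)" "q (prefix_code 0 p (seq_len w)) = forced q w"
    using assms(2,3) decides_agree prefix_code_agree unfolding constraint_def forced_def by metis+
  then show ?thesis using assms(1) unfolding clopens_eq_Some_iff by (metis diff_Suc_1)
qed

lemma forced_pos: "constraint q l w \<Longrightarrow> 0 < forced q w"
  by (simp add: constraint_def forced_def decides_def)

lemma evidence_agree:
  assumes "agree l q q'" shows "evidence q l = evidence q' l"
proof -
  have q: "q' i = q i" if "i < l" for i using assms that by (simp add: agree_def)
  have forced: "forced q' w = forced q w" if "prefix_code 0 (seq_nth w) (seq_len w) < l" for w
    using q that by (simp add: forced_def)
  have "decides q' 0 (seq_nth w) (seq_len w) = decides q 0 (seq_nth w) (seq_len w)"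
    if "prefix_code 0 (seq_nth w) (seq_len w) < l" for w
  proof -
    have "prefix_code 0 (seq_nth w) j < l" if "j \<le> seq_len w" for j
      using prefix_code_mono[OF that, of 0 "seq_nth w"] \<open>_ < l\<close> by linarith
    then show ?thesis using q by (simp add: decides_def)
  qed
  then have con: "constraint q' l w = constraint q l w" for w
    unfolding constraint_def by blast
  have ref: "constraint q l w \<and> refutes_digit q' w j a \<longleftrightarrow> constraint q l w \<and> refutes_digit q w j a" for w j a
    using forced unfolding refutes_digit_def constraint_def by auto
  have "digits_determined q' l s = digits_determined q l s" for s
    unfolding digits_determined_def con ref by (rule refl)
  moreover have "contradicts q' l s = contradicts q l s" for s
    unfolding contradicts_def con clashes_def using forced unfolding constraint_def
    by (intro ex_cong1) auto
  ultimately show ?thesis unfolding evidence_def by simp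
qed


lemma read_code_agree:
  assumes "agree k r r'" "w \<le> k" shows "read_code r n d m w = read_code r' n d m w"
  unfolding read_code_def
proof (rule reading_agree[OF agree_refl assms(1)])
  show "seq_len w \<le> k" using seq_len_le[of w] assms(2) by linarith
  assume "1 < seq_len w"
  then show "seq_nth w 1 < k" using seq_nth_less[of 1 w] assms(2) by linarith
qed

lemma clashes_agree:
  assumes "agree k r r'" "w \<le> k" shows "clashes q w r k = clashes q w r' k"
proof -
  have "seen r 0 0 0 (seq_len w) = seen r' 0 0 0 (seq_len w)"
    by (rule seen_agree[OF agree_mono[OF assms(1)]]) (use seq_len_le[of w] assms(2) in linarith)
  moreover have "first_certified r c = first_certified r' c" if "c < Suc k" for c
    by (rule first_certified_agree[OF assms(1)]) (use that in simp)
  ultimately show ?thesis unfolding clashes_def read_code_agree[OF assms] by blast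
qed

text \<open>
By \<open>reading_of_constant\<close>, every constraint on a name of a removed point is matched by a reading. Hence the
digits that are not refuted are those of \<open>r\<close>, and no clash can occur.
\<close>

lemma evidence_sound:
  assumes x: "clopens q = Some x" and ev: "evidence q l" shows "x \<notin> removed"
proof
  assume "x \<in> removed"
  then obtain r c where r: "r \<in> wellfounded_codes" and c: "first_certified r c"
    and xr: "x = certified_point r c" unfolding removed_def by blast
  define n where "n = pfst c"
  define m where "m = Suc (pfst (psnd c))"
  have n: "0 < n" using c certified_imp_pos[of r c] unfolding n_def first_certified_def by blast
  have read: "read_code r n n m w = forced q w" if w: "constraint q k w" for k w
  proof -
    have "reading r n n m (seq_nth w) (seq_len w) = Suc (forced q w - 1)"
      by (rule reading_of_constant[OF r n])
        (use constraint_forces[OF x w] xr in \<open>simp_all add: n_def m_def\<close>)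
    then show ?thesis using forced_pos[OF w] by (simp add: read_code_def)
  qed
  have digit: "\<not> refutes_digit q w j (r j)" "r j < seq_len w" if "constraint q k w" "about_digit j w" for k w j
    using read[OF that(1)] forced_pos[OF that(1)] that(2)
    by (auto simp: read_code_def reading_def refutes_digit_def about_digit_def split: if_splits)
  obtain s where s: "digits_determined q l s" "contradicts q l s"
    using ev unfolding evidence_def by blast
  have agree: "agree (seq_len s) (seq_nth s) r"
    unfolding agree_def
  proof (intro allI impI)
    fix j assume "j < seq_len s"
    then obtain w where "constraint q l w" "about_digit j w"
      "\<forall>a<seq_len w. a \<noteq> seq_nth s j \<longrightarrow> (\<exists>w'<l. constraint q l w' \<and> refutes_digit q w' j a)"
      using s(1) unfolding digits_determined_def by blast
    then show "seq_nth s j = r j" using digit unfolding refutes_digit_def by metis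
  qed
  obtain w where w: "constraint q l w" "w \<le> seq_len s" "clashes q w (seq_nth s) (seq_len s)"
    using s(2) unfolding contradicts_def by blast
  have "clashes q w r (seq_len s)" using w clashes_agree[OF agree] by blast
  then consider "seq_nth w 0 \<noteq> 2" "seq_nth w 0 \<noteq> 3" "read_code r 0 0 0 w \<noteq> forced q w"
    | "seq_nth w 0 = 3" "\<not> seen r 0 0 0 (seq_len w)"
    | c' where "first_certified r c'"
      "read_code r (pfst c') (pfst c') (Suc (pfst (psnd c'))) w \<noteq> forced q w"
    unfolding clashes_def by blast
  then show False
  proof cases
    case 1
    then have "read_code r 0 0 0 w = read_code r n n m w" by (simp add: read_code_def reading_def)
    then show False using 1 read[OF w(1)] by simp
  next
    case 2
    then have "n < seq_len w" using read[OF w(1)] forced_pos[OF w(1)]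
      by (auto simp: read_code_def reading_def split: if_splits)
    moreover have "seen r 0 0 0 n" using c by (simp add: first_certified_def certified_def n_def)
    ultimately show False using seen_mono 2(2) by (meson less_imp_le)
  next
    case 3
    then have "c' = c" using c first_certified_unique by blast
    then show False using 3 read[OF w(1)] by (simp add: n_def m_def)
  qed
qed

text \<open>
The digit that no constraint refutes, if there is one, and otherwise an arbitrary number.
\<close>

definition decoded :: "baire \<Rightarrow> baire" where
  "decoded q j = (SOME a. \<not> (\<exists>l w. constraint q l w \<and> refutes_digit q w j a))"

lemma constraint_at:
  assumes "clopens q = Some x"
  obtains k where "constraint q (Suc (prefix_code 0 p k)) (init_code p k)" "forced q (init_code p k) = Suc (x p)"
proof -
  obtain k where "decides q 0 p k" "q (prefix_code 0 p k) = Suc (x p)"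
    using assms unfolding clopens_eq_Some_iff by blast
  then show ?thesis using that[of k] constraint_init_code[of q p k "Suc (prefix_code 0 p k)"] by simp
qed

text \<open>
Two different candidates \<open>a\<close> and \<open>a'\<close> cannot both survive: at a sequence with entry 0 at \<open>a\<close> and
entry 1 at \<open>a'\<close> they predict different values, so the constraint there refutes one of them.
\<close>

lemma digit_refuted:
  assumes x: "clopens q = Some x" and "a \<noteq> decoded q j"
  shows "\<exists>l w. constraint q l w \<and> refutes_digit q w j a"
proof (rule ccontr)
  assume a: "\<not> ?thesis"
  define a' where "a' = decoded q j"
  have a': "\<not> (\<exists>l w. constraint q l w \<and> refutes_digit q w j a')"
    unfolding a'_def decoded_def by (rule someI[of _ a]) (rule a)
  define p :: baire where "p i = (if i = 1 then j else if i = a' + 2 then 1 else 0)" for i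
  obtain k where k: "constraint q (Suc (prefix_code 0 p k)) (init_code p k)" by (rule constraint_at[OF x])
  have "about_digit j (init_code p k)" by (auto simp: about_digit_def seq_nth_init_code p_def)
  moreover have "\<not> refutes_digit q (init_code p k) j a" "\<not> refutes_digit q (init_code p k) j a'"
    using a a' k by blast+
  ultimately have "a + 2 < k \<and> forced q (init_code p k) = Suc (p (a + 2) mod 2)"
    "a' + 2 < k \<and> forced q (init_code p k) = Suc (p (a' + 2) mod 2)"
    by (auto simp: refutes_digit_def seq_nth_init_code)
  then show False using assms(2) by (simp add: p_def a'_def)
qed

lemma eventually_constraint: "constraint q k w \<Longrightarrow> \<forall>\<^sub>F l in sequentially. constraint q l w"
  by (rule eventually_sequentiallyI[of k]) (rule constraint_mono)

lemma eventually_digits_determined: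
  assumes x: "clopens q = Some x"
  shows "\<forall>\<^sub>F l in sequentially. digits_determined q l (init_code (decoded q) k)"
proof -
  have "\<forall>\<^sub>F l in sequentially. \<exists>w<l. constraint q l w \<and> about_digit j w \<and>
     (\<forall>a<seq_len w. a \<noteq> decoded q j \<longrightarrow> (\<exists>w'<l. constraint q l w' \<and> refutes_digit q w' j a))" for j
  proof -
    define p :: baire where "p i = (if i = 1 then j else 0)" for i
    obtain i where i: "constraint q (Suc (prefix_code 0 p i)) (init_code p i)" by (rule constraint_at[OF x])
    have about: "about_digit j (init_code p i)" by (auto simp: about_digit_def seq_nth_init_code p_def)
    have "\<forall>\<^sub>F l in sequentially. \<forall>a\<in>{a. a < i \<and> a \<noteq> decoded q j}.
        \<exists>w'<l. constraint q l w' \<and> refutes_digit q w' j a"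
    proof (intro eventually_ball_finite ballI)
      fix a assume "a \<in> {a. a < i \<and> a \<noteq> decoded q j}"
      then obtain l w where "constraint q l w" "refutes_digit q w j a"
        using digit_refuted[OF x] by blast
      then show "\<forall>\<^sub>F l in sequentially. \<exists>w'<l. constraint q l w' \<and> refutes_digit q w' j a"
        using eventually_constraint[of q l w] constraint_imp_less by (auto elim!: eventually_mono)
    qed simp
    with eventually_constraint[OF i] show ?thesis
      by eventually_elim (use about constraint_imp_less in \<open>intro exI[of _ "init_code p i"], auto\<close>)
  qed
  then have "\<forall>\<^sub>F l in sequentially. \<forall>j\<in>{..<k}. \<exists>w<l. constraint q l w \<and> about_digit j w \<and>
     (\<forall>a<seq_len w. a \<noteq> decoded q j \<longrightarrow> (\<exists>w'<l. constraint q l w' \<and> refutes_digit q w' j a))"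
    by (intro eventually_ball_finite) auto
  then show ?thesis
    by eventually_elim (simp add: digits_determined_def seq_nth_init_code)
qed

text \<open>
If no constraint clashes with the decoded code \<open>r\<close>, then component 1 shows that \<open>r\<close> is
well-founded, component 3 that \<open>x\<^sub>r\<close> has been seen, so that a point is removed for \<open>r\<close>, and all
components together that this is the given point.
\<close>

lemma evidence_complete:
  assumes x: "clopens q = Some x" and "x \<notin> removed" shows "\<exists>l. evidence q l"
proof -
  let ?r = "decoded q"
  have "\<exists>l w k. constraint q l w \<and> w \<le> k \<and> clashes q w ?r k"
  proof (rule ccontr)
    assume "\<not> ?thesis"
    then have none: "\<not> clashes q w ?r k" if "constraint q l w" "w \<le> k" for l w k
      using that by blast
    have wf: "?r \<in> wellfounded_codes"
      unfolding wellfounded_codes_def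
    proof (intro CollectI allI)
      fix p
      define p' :: baire where "p' i = (case i of 0 \<Rightarrow> 1 | Suc i \<Rightarrow> prod_encode (p i, 0))" for i
      obtain k where k: "constraint q (Suc (prefix_code 0 p' k)) (init_code p' k)"
        "forced q (init_code p' k) = Suc (x p')" by (rule constraint_at[OF x])
      have tag: "seq_nth (init_code p' k) 0 \<noteq> 2" "seq_nth (init_code p' k) 0 \<noteq> 3"
        by (simp_all add: seq_nth_init_code p'_def)
      have "reading ?r 0 0 0 p' k = Suc (x p')"
        using none[OF k(1) order_refl] k(2) tag by (auto simp: clashes_def read_code_init_code)
      then have "exit_time ?r p (k - 1) < k - 1"
        by (auto simp: reading_def p'_def split: if_splits)
      then show "\<exists>k. \<tau> ?r p k" using exit_time_less by blast
    qed
    define p :: baire where "p i = (if i = 0 then 3 else 0)" for i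
    obtain k where k: "constraint q (Suc (prefix_code 0 p k)) (init_code p k)"
      "forced q (init_code p k) = Suc (x p)" by (rule constraint_at[OF x])
    have "k \<noteq> 0"
    proof
      assume "k = 0"
      then show False using none[OF k(1) order_refl] k(2)
        by (auto simp: clashes_def read_code_init_code seq_nth_init_code reading_def)
    qed
    then have "seen ?r 0 0 0 k"
      using none[OF k(1) order_refl] by (auto simp: clashes_def seq_nth_init_code p_def)
    then obtain c where c: "first_certified ?r c" using seen_imp_certified[OF wf] by blast
    have "x = certified_point ?r c"
    proof
      fix p
      obtain k where k: "constraint q (Suc (prefix_code 0 p k)) (init_code p k)"
        "forced q (init_code p k) = Suc (x p)" by (rule constraint_at[OF x])
      have "reading ?r (pfst c) (pfst c) (Suc (pfst (psnd c))) p k = Suc (x p)"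
        using none[OF k(1), of "max (init_code p k) c"] k(2) c by (auto simp: clashes_def read_code_init_code)
      then show "x p = certified_point ?r c p"
        using reading_eq_point[of ?r "pfst c" "pfst c" "Suc (pfst (psnd c))" p k] by simp
    qed
    then show False using assms(2) wf c unfolding removed_def by blast
  qed
  then obtain l w k where w: "constraint q l w" "w \<le> k" "clashes q w ?r k" by blast
  define s where "s = init_code ?r k"
  have "clashes q w (seq_nth s) k"
    using w(3) clashes_agree[OF agree_seq_nth_init_code w(2)] by (simp add: s_def)
  then have "\<forall>\<^sub>F l in sequentially. digits_determined q l s \<and> constraint q l w \<and> s < l"
    unfolding s_def
    by (intro eventually_conj eventually_digits_determined[OF x] eventually_constraint[OF w(1)]
        eventually_gt_at_top)
  then obtain l where "digits_determined q l s" "constraint q l w" "s < l"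
    using eventually_happens'[OF sequentially_bot] by blast
  then have "evidence q l"
    unfolding evidence_def contradicts_def using \<open>clashes q w (seq_nth s) k\<close> w(2) constraint_imp_less
    by (metis s_def seq_len_init_code)
  then show ?thesis by blast
qed

theorem evidence_iff:
  "clopens q = Some x \<Longrightarrow> (\<exists>l. evidence q l) \<longleftrightarrow> x \<notin> removed"
  using evidence_sound evidence_complete by blast

definition diagonal_open :: "(baire \<Rightarrow> nat) \<Rightarrow> sierpinski" where
  "diagonal_open = restrict (\<lambda>x. if x \<in> - removed then Top else Bot) (carrier clopens)"

theorem open_space_diagonal: "open_space clopens (semidecision_name evidence) = Some diagonal_open"
  unfolding diagonal_open_def
  by (rule open_space_semidecision_name[where E = evidence]) (simp_all add: evidence_agree evidence_iff)

theorem diagonal_open_differs: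
  assumes r: "r \<in> wellfounded_codes" and u: "\<And>i. open_space clopens (section_of r (2 * i)) = Some (u i)"
  shows "open_set_of clopens diagonal_open \<noteq> (\<Union>i. open_set_of clopens (u i))"
proof
  assume eq: "open_set_of clopens diagonal_open = (\<Union>i. open_set_of clopens (u i))"
  obtain q x where x: "clopens q = Some x"
    and "x \<in> removed \<longleftrightarrow> (\<exists>i. accepts (section_of r (2 * i)) q)"
    using diagonal[OF r] by blast
  moreover have "accepts (section_of r (2 * i)) q \<longleftrightarrow> x \<in> open_set_of clopens (u i)" for i
    using open_space_value[of clopens "section_of r (2 * i)" "u i" q x] u[of i] x
    by (auto simp: open_set_of_def ran_def)
  moreover have "x \<in> open_set_of clopens diagonal_open \<longleftrightarrow> x \<notin> removed"
    using x by (auto simp: open_set_of_def ran_def diagonal_open_def)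
  ultimately show False using eq by blast
qed

lemma diagonal_open_nonempty: "open_set_of clopens diagonal_open \<noteq> {}"
proof -
  have "clopens (\<lambda>_. 2) = Some (\<lambda>_. 1)"
    by (auto simp: clopens_eq_Some_iff decides_def)
  moreover have "(\<lambda>_. 1) \<notin> removed"
  proof
    assume "(\<lambda>_. 1) \<in> removed"
    then obtain r n d m where "point r n d m = (\<lambda>_. 1)" unfolding removed_def by force
    moreover have "reading r n d m (\<lambda>_. 4) 1 = 1" by (simp add: reading_def)
    ultimately show False using reading_eq_point[of r n d m "\<lambda>_. 4" 1] by simp
  qed
  ultimately show ?thesis by (auto simp: open_set_of_def ran_def diagonal_open_def)
qed

end


section \<open>Computability of the diagonal set\<close>

text \<open>
The finite evidence is a bounded search through decidable conditions, so the name of the diagonal set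
is recursive as soon as \<open>\<tau>\<close> is decidable for recursive parameters.
\<close>

locale recursive_exit_test = exit_test +
  assumes decidable_exit [recursive_intros]:
    "total_recursive (\<lambda>e. r (pfst e) (psnd e)) \<Longrightarrow> total_recursive (\<lambda>e. p (pfst e) (psnd e)) \<Longrightarrow>
      total_recursive k \<Longrightarrow> decidable (\<lambda>x. \<tau> (\<lambda>i. r i x) (\<lambda>i. p i x) (k x))"
begin

lemma total_recursive_exit_time [recursive_intros]:
  assumes r: "total_recursive (\<lambda>e. r (pfst e) (psnd e))" and p: "total_recursive (\<lambda>e. p (pfst e) (psnd e))"
    and k: "total_recursive k"
  shows "total_recursive (\<lambda>x. exit_time (\<lambda>i. r i x) (\<lambda>i. p i x) (k x))"
  unfolding exit_time_def
  by (intro recursive_intros total_recursive_compose2[OF r] total_recursive_compose2[OF p]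
      total_recursive_compose[OF k]) auto

lemma total_recursive_reading [recursive_intros]:
  assumes r: "total_recursive (\<lambda>e. r (pfst e) (psnd e))" and p: "total_recursive (\<lambda>e. p (pfst e) (psnd e))"
    and "total_recursive n" "total_recursive d" "total_recursive m" "total_recursive k"
  shows "total_recursive (\<lambda>x. reading (\<lambda>i. r i x) (n x) (d x) (m x) (\<lambda>i. p i x) (k x))"
  unfolding reading_def
  by (intro recursive_intros assms total_recursive_compose2[OF r] total_recursive_compose2[OF p])

lemma total_recursive_name_of_point [recursive_intros]:
  assumes r: "total_recursive (\<lambda>e. r (pfst e) (psnd e))"
    and "total_recursive n" "total_recursive d" "total_recursive m" "total_recursive c"
  shows "total_recursive (\<lambda>x. name_of_point (\<lambda>i. r i x) (n x) (d x) (m x) (c x))"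
  unfolding name_of_point_def
  by (intro recursive_intros assms total_recursive_compose2[OF r] total_recursive_compose[OF assms(5)])

lemma decidable_seen [recursive_intros]:
  assumes r: "total_recursive (\<lambda>e. r (pfst e) (psnd e))"
    and n: "total_recursive n" and d: "total_recursive d" and m: "total_recursive m" and l: "total_recursive l"
  shows "decidable (\<lambda>x. seen (\<lambda>i. r i x) (n x) (d x) (m x) (l x))"
  unfolding seen_def
  by (intro recursive_intros assms total_recursive_compose2[OF r] total_recursive_compose[OF n]
      total_recursive_compose[OF d] total_recursive_compose[OF m] total_recursive_compose[OF l])

lemma decidable_first_certified [recursive_intros]:
  assumes r: "total_recursive (\<lambda>e. r (pfst e) (psnd e))" and c: "total_recursive c"
  shows "decidable (\<lambda>x. first_certified (\<lambda>i. r i x) (c x))"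
  unfolding first_certified_def certified_def
  by (intro recursive_intros assms total_recursive_compose2[OF r] total_recursive_compose[OF c])

end

locale recursive_coded_families = coded_families + recursive_exit_test
begin

lemma decidable_constraint [recursive_intros]:
  assumes q: "total_recursive (\<lambda>e. q (pfst e) (psnd e))"
    and "total_recursive l" and w: "total_recursive w"
  shows "decidable (\<lambda>x. constraint (\<lambda>i. q i x) (l x) (w x))"
  unfolding constraint_def
  by (intro recursive_intros assms total_recursive_compose2[OF q] total_recursive_compose[OF w])

lemma total_recursive_forced [recursive_intros]:
  assumes q: "total_recursive (\<lambda>e. q (pfst e) (psnd e))" and w: "total_recursive w"
  shows "total_recursive (\<lambda>x. forced (\<lambda>i. q i x) (w x))"
  unfolding forced_def
  by (intro recursive_intros assms total_recursive_compose2[OF q] total_recursive_compose[OF w])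

lemma total_recursive_read_code [recursive_intros]:
  assumes r: "total_recursive (\<lambda>e. r (pfst e) (psnd e))"
    and "total_recursive n" "total_recursive d" "total_recursive m" and w: "total_recursive w"
  shows "total_recursive (\<lambda>x. read_code (\<lambda>i. r i x) (n x) (d x) (m x) (w x))"
  unfolding read_code_def
  by (intro recursive_intros assms total_recursive_compose2[OF r] total_recursive_compose[OF w])

lemma decidable_evidence:
  assumes q: "total_recursive (\<lambda>e. q (pfst e) (psnd e))" and l: "total_recursive l"
  shows "decidable (\<lambda>x. evidence (\<lambda>i. q i x) (l x))"
  unfolding evidence_def digits_determined_def contradicts_def clashes_def refutes_digit_def about_digit_def
  by (intro recursive_intros assms total_recursive_compose2[OF q] total_recursive_compose[OF l])

theorem diagonal_open_computable: "diagonal_open \<in> computable_opens clopens"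
proof -
  have "computable_point (semidecision_name evidence)"
    by (intro total_recursive_imp_computable_point total_recursive_semidecision_name decidable_evidence)
  then show ?thesis
    unfolding computable_opens_def computable_element_def using open_space_diagonal by blast
qed

end

section \<open>No base indexed by the continuous functionals\<close>

lemma openin_diagonal_open:
  assumes "coded_families \<tau>"
  shows "openin (final_topology clopens) (open_set_of clopens (coded_families.diagonal_open \<tau>))"
proof -
  interpret coded_families \<tau> by (rule assms)
  have "open {q. \<exists>l. evidence q l}"
    by (rule open_locally_determined) (use evidence_agree in blast)
  moreover have "{q. \<exists>x\<in>open_set_of clopens diagonal_open. clopens q = Some x} =
      dom clopens \<inter> {q. \<exists>l. evidence q l}"
  proof (rule set_eqI)
    fix q
    show "q \<in> {q. \<exists>x\<in>open_set_of clopens diagonal_open. clopens q = Some x} \<longleftrightarrow>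
        q \<in> dom clopens \<inter> {q. \<exists>l. evidence q l}"
    proof (cases "clopens q")
      case (Some x)
      then have "x \<in> open_set_of clopens diagonal_open \<longleftrightarrow> (\<exists>l. evidence q l)"
        unfolding evidence_iff[OF Some] by (auto simp: open_set_of_def diagonal_open_def ran_def)
      then show ?thesis using Some by auto
    qed auto
  qed
  ultimately show ?thesis
    unfolding openin_final_topology by (auto simp: openin_open open_set_of_def)
qed

text \<open>
A represented space is a quotient of a second countable space, hence hereditarily Lindelof.
\<close>

lemma countable_subcover_final_topology:
  assumes "\<And>B. B \<in> \<B> \<Longrightarrow> openin (final_topology X) B"
  shows "\<exists>\<B>'\<subseteq>\<B>. countable \<B>' \<and> \<Union>\<B>' = \<Union>\<B>"
proof -
  define preimage_of where "preimage_of B = {p. \<exists>x\<in>B. X p = Some x}" for B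
  have "openin (top_of_set (dom X)) V" if "V \<in> preimage_of ` \<B>" for V
    using that assms unfolding openin_final_topology preimage_of_def by auto
  then obtain \<V> where \<V>: "\<V> \<subseteq> preimage_of ` \<B>" "countable \<V>" "\<Union>\<V> = \<Union>(preimage_of ` \<B>)"
    using Lindelof_openin[of "preimage_of ` \<B>" "dom X"] by blast
  obtain \<B>' where \<B>': "\<B>' \<subseteq> \<B>" "countable \<B>'" "\<V> = preimage_of ` \<B>'"
    using \<V>(1,2) countable_subset_image[of \<V> preimage_of \<B>] by (elim iffE) blast
  have "\<Union>\<B> \<subseteq> \<Union>\<B>'"
  proof
    fix x assume "x \<in> \<Union>\<B>"
    then obtain B where B: "B \<in> \<B>" "x \<in> B" by blast
    then have "x \<in> carrier X" using assms[OF B(1)] unfolding openin_final_topology by blast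
    then obtain p where p: "X p = Some x" by (auto simp: ran_def)
    then have "p \<in> preimage_of B" using B(2) by (auto simp: preimage_of_def)
    then have "p \<in> \<Union>\<V>" unfolding \<V>(3) using B(1) by blast
    then obtain B' where "B' \<in> \<B>'" "p \<in> preimage_of B'" unfolding \<B>'(3) by blast
    moreover from this have "x \<in> B'" using p by (auto simp: preimage_of_def)
    ultimately show "x \<in> \<Union>\<B>'" by blast
  qed
  then show ?thesis using \<B>' by blast
qed

text \<open>
A code consists of names \<open>\<eta>\<^sub>i\<close> of functionals, in the odd sections, together with the names of the
basic open sets assigned to them, in the even sections. That \<open>\<eta>\<^sub>i\<close> is a name says that \<open>\<eta>\<^sub>i\<close> answers
on every \<open>p\<close>, which is a condition of the required form; that the assigned name is correct is an
arithmetical condition relative to an associate \<open>g\<close> of the realizer.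
\<close>

theorem clopens_not_based_on_functionals:
  "\<not> based_on clopens (fun_space baire_space nat_space)"
proof
  let ?Y = "fun_space baire_space nat_space"
  assume "based_on clopens ?Y"
  then obtain f F where F: "continuous_on (dom ?Y) F" "realizes ?Y (open_space clopens) F f"
    and basis: "basis_of (final_topology clopens) ((\<lambda>y. open_set_of clopens (f y)) ` carrier ?Y)"
    unfolding based_on_def continuous_fun_def by blast
  obtain g where g: "encodes_on (dom ?Y) g F" using ex_encodes_on[OF F(1)] by blast
  \<comment> \<open>The first entry of \<open>p\<close> selects a section and the second a question
    \<open>n\<close>; the rest is an argument of the functional.\<close>
  define holds where "holds r p \<longleftrightarrow>
     (\<exists>k. section_of r (2 * p 0 + 1) (prefix_code (p 1) (\<lambda>t. p (t + 2)) k) \<noteq> 0) \<and>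
     (\<exists>k. decides g (p 1) (section_of r (2 * p 0 + 1)) k \<and>
          g (prefix_code (p 1) (section_of r (2 * p 0 + 1)) k) = Suc (section_of r (2 * p 0) (p 1)))"
    for r p :: baire
  \<comment> \<open>The largest local test with the same well-founded codes.\<close>
  define \<tau> where "\<tau> r p k \<longleftrightarrow> (\<forall>r' p'. agree k r r' \<longrightarrow> agree k p p' \<longrightarrow> holds r' p')" for r p k
  have agree_trans: "agree k q q' \<Longrightarrow> agree k q' q'' \<Longrightarrow> agree k q q''" for k q q' q''
    by (simp add: agree_def)
  interpret exit_test \<tau>
  proof
    show "\<tau> r p k = \<tau> r' p' k" if "agree k r r'" "agree k p p'" for k r r' p p'
      unfolding \<tau>_def using that agree_trans agree_sym by meson
  qed
  have holds_open: "\<exists>k. \<tau> r p k" if rp: "holds r p" for r p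
  proof -
    let ?s = "2 * p 0 + 1"
    obtain k1 where k1: "section_of r ?s (prefix_code (p 1) (\<lambda>t. p (t + 2)) k1) \<noteq> 0"
      using rp unfolding holds_def by blast
    obtain k2 where k2: "decides g (p 1) (section_of r ?s) k2"
        "g (prefix_code (p 1) (section_of r ?s) k2) = Suc (section_of r (2 * p 0) (p 1))"
      using rp unfolding holds_def by blast
    define c where "c = prefix_code (p 1) (\<lambda>t. p (t + 2)) k1"
    define K where "K = k1 + 3 + prod_encode (?s, c) + prod_encode (?s, k2) + prod_encode (2 * p 0, p 1)"
    have "holds r' p'" if r': "agree K r r'" and p': "agree K p p'" for r' p'
    proof -
      have p_eq: "p' i = p i" if "i < K" for i using p' that by (simp add: agree_def)
      have r_eq: "r' i = r i" if "i < K" for i using r' that by (simp add: agree_def)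
      have p01: "p' 0 = p 0" "p' 1 = p 1" using p_eq by (simp_all add: K_def)
      have "prefix_code (p 1) (\<lambda>t. p' (t + 2)) k1 = c"
        unfolding c_def by (rule prefix_code_cong) (simp add: p_eq K_def)
      moreover have "section_of r' ?s c = section_of r ?s c"
        unfolding section_of_def by (rule r_eq) (simp add: K_def)
      ultimately have "section_of r' ?s (prefix_code (p 1) (\<lambda>t. p' (t + 2)) k1) \<noteq> 0"
        using k1 by (simp add: c_def)
      moreover have "agree k2 (section_of r ?s) (section_of r' ?s)"
        unfolding agree_def section_of_def
      proof (intro allI impI)
        fix t assume "t < k2"
        then have "prod_encode (?s, t) \<le> prod_encode (?s, k2)" by (intro prod_encode_mono) auto
        then show "r (prod_encode (?s, t)) = r' (prod_encode (?s, t))"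
          using r_eq[of "prod_encode (?s, t)"] by (simp add: K_def)
      qed
      then have "decides g (p 1) (section_of r' ?s) k2"
        "g (prefix_code (p 1) (section_of r' ?s) k2) = g (prefix_code (p 1) (section_of r ?s) k2)"
        using k2(1) by (simp_all add: decides_agree decides_agree_value)
      moreover have "section_of r' (2 * p 0) (p 1) = section_of r (2 * p 0) (p 1)"
        unfolding section_of_def by (rule r_eq) (simp add: K_def)
      ultimately show ?thesis unfolding holds_def p01 using k2(2) by metis
    qed
    then show ?thesis unfolding \<tau>_def by blast
  qed
  have wf_iff: "r \<in> wellfounded_codes \<longleftrightarrow> (\<forall>p. holds r p)" for r
  proof -
    have "(\<exists>k. \<tau> r p k) \<longleftrightarrow> holds r p" for p
      using holds_open unfolding \<tau>_def by (meson agree_refl)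
    then show ?thesis unfolding wellfounded_codes_def by simp
  qed
  have wf_value: "section_of r (2 * i + 1) \<in> dom ?Y \<and> section_of r (2 * i) = F (section_of r (2 * i + 1))"
    if r: "r \<in> wellfounded_codes" for r i
  proof -
    define shift :: "nat \<Rightarrow> baire \<Rightarrow> baire" where
      "shift n p t = (if t = 0 then i else if t = 1 then n else p (t - 2))" for n p t
    have shift: "shift n p 0 = i" "shift n p 1 = n" "(\<lambda>t. shift n p (t + 2)) = p" for n p
      by (auto simp: shift_def)
    have holds: "holds r (shift n p)" for n p using r wf_iff by blast
    have y: "section_of r (2 * i + 1) \<in> dom ?Y"
      unfolding dom_fun_space_nat_iff ex_decides_iff
      using holds unfolding holds_def shift by blast
    have "section_of r (2 * i) n = F (section_of r (2 * i + 1)) n" for n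
    proof -
      obtain k where k: "decides g n (section_of r (2 * i + 1)) k"
        "g (prefix_code n (section_of r (2 * i + 1)) k) = Suc (section_of r (2 * i) n)"
        using holds[of n] unfolding holds_def shift by blast
      obtain k' where "decides g n (section_of r (2 * i + 1)) k'"
        "g (prefix_code n (section_of r (2 * i + 1)) k') = Suc (F (section_of r (2 * i + 1)) n)"
        using g y unfolding encodes_on_iff_decides by blast
      then show ?thesis using k decides_unique by (metis nat.inject)
    qed
    then show ?thesis using y by blast
  qed
  interpret coded_families \<tau>
  proof
    show "section_of r (2 * i) \<in> dom (open_space clopens)" if "r \<in> wellfounded_codes" for r i
      using wf_value[OF that, of i] F(2) unfolding realizes_def by fastforce
  qed
  let ?W = "open_set_of clopens diagonal_open"
  have "openin (final_topology clopens) ?W"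
    by (rule openin_diagonal_open) (rule coded_families_axioms)
  then have "\<exists>\<B>\<subseteq>(\<lambda>y. open_set_of clopens (f y)) ` carrier ?Y. \<Union>\<B> = ?W"
    using basis[unfolded basis_of_def, THEN conjunct2] by (elim allE impE)
  then obtain \<B> where \<B>: "\<B> \<subseteq> (\<lambda>y. open_set_of clopens (f y)) ` carrier ?Y" "\<Union>\<B> = ?W"
    by (elim exE conjE)
  have "openin (final_topology clopens) B" if "B \<in> \<B>" for B
    using basis[unfolded basis_of_def, THEN conjunct1] subsetD[OF \<B>(1) that] by (rule bspec)
  then have "\<exists>\<B>'\<subseteq>\<B>. countable \<B>' \<and> \<Union>\<B>' = ?W"
    unfolding \<B>(2)[symmetric] by (rule countable_subcover_final_topology)
  then obtain \<B>' where \<B>': "\<B>' \<subseteq> \<B>" "countable \<B>'" "\<Union>\<B>' = ?W"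
    by (elim exE conjE)
  have "\<B>' \<noteq> {}" using diagonal_open_nonempty \<B>'(3) by fastforce
  then have range: "range (from_nat_into \<B>') = \<B>'" using \<B>'(2) by simp
  have "\<exists>\<eta> y. ?Y \<eta> = Some y \<and> from_nat_into \<B>' i = open_set_of clopens (f y)" for i
  proof -
    have "from_nat_into \<B>' i \<in> (\<lambda>y. open_set_of clopens (f y)) ` carrier ?Y"
      using range \<B>'(1) \<B>(1) by blast
    then show ?thesis by (auto simp: ran_def)
  qed
  then obtain \<eta> y where \<eta>: "\<And>i. ?Y (\<eta> i) = Some (y i)"
    and y: "\<And>i. from_nat_into \<B>' i = open_set_of clopens (f (y i))" by metis
  define r where
    "r c = (if even (pfst c) then F (\<eta> (pfst c div 2)) (psnd c) else \<eta> (pfst c div 2) (psnd c))" for c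
  have even: "section_of r (2 * i) = F (\<eta> i)" and odd: "section_of r (2 * i + 1) = \<eta> i" for i
    by (auto simp: section_of_def r_def)
  have \<eta>_dom: "\<eta> i \<in> dom ?Y" for i using \<eta> by blast
  have "holds r p" for p
    unfolding holds_def even odd
  proof
    show "\<exists>k. \<eta> (p 0) (prefix_code (p 1) (\<lambda>t. p (t + 2)) k) \<noteq> 0"
      using \<eta>_dom[of "p 0"] unfolding dom_fun_space_nat_iff ex_decides_iff by blast
    show "\<exists>k. decides g (p 1) (\<eta> (p 0)) k \<and> g (prefix_code (p 1) (\<eta> (p 0)) k) = Suc (F (\<eta> (p 0)) (p 1))"
      using g \<eta>_dom unfolding encodes_on_iff_decides by blast
  qed
  then have "r \<in> wellfounded_codes" using wf_iff by blast
  moreover have "open_space clopens (section_of r (2 * i)) = Some (f (y i))" for i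
    using F(2) \<eta>[of i] unfolding realizes_def even by blast
  ultimately have "?W \<noteq> (\<Union>i. open_set_of clopens (f (y i)))"
    by (rule diagonal_open_differs)
  moreover have "(\<Union>i. open_set_of clopens (f (y i))) = ?W"
    using range \<B>'(3) by (simp add: y[symmetric])
  ultimately show False by simp
qed

section \<open>No effective enumeration\<close>

lemma Sigma1_pos: "Sigma1 k P \<Longrightarrow> 0 < k"
  by (induction rule: Sigma1.induct) auto

text \<open>
The matrix of a \<open>\<Sigma>\<^sup>1\<^sub>2\<close> definition is \<open>\<Sigma>\<^sup>0\<^sub>1\<close>, so its truth is a matter of some fuel being sufficient.
\<close>

lemma Sigma1_set_2_normal_form:
  assumes "Sigma1_set 2 S"
  shows "\<exists>e. \<forall>n. n \<in> S \<longleftrightarrow> (\<exists>y. \<forall>p. \<exists>k. beval e k (join p (join y (\<lambda>_. 0))) (seq_cons n 0) \<noteq> 0)"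
proof -
  have "Sigma1 2 (\<lambda>p n. n \<in> S)" using assms by (simp add: Sigma1_set_def)
  then obtain Q where Q: "Sigma1 1 (\<lambda>p n. \<not> Q p n)" "(\<lambda>p n. n \<in> S) = (\<lambda>p n. \<exists>q. Q (join q p) n)"
    by cases auto
  from Q(1) obtain R where R: "semirecursive (\<lambda>p n. \<not> R p n)"
    "(\<lambda>p n. \<not> Q p n) = (\<lambda>p n. \<exists>q. R (join q p) n)"
    by cases (auto dest: Sigma1_pos)
  obtain e where e: "\<And>p n. \<not> R p n \<longleftrightarrow> eval e p [n] \<noteq> None"
    using R(1) unfolding semirecursive_def by blast
  have run: "\<not> R q n \<longleftrightarrow> (\<exists>k. beval e k q (seq_cons n 0) \<noteq> 0)" for q n
  proof -
    have "\<not> R q n \<longleftrightarrow> (\<exists>v. eval e q [n] = Some v)" unfolding e by auto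
    also have "\<dots> \<longleftrightarrow> (\<exists>v k. beval e k q (seq_cons n 0) = Suc v)"
      by (simp only: eval_iff_beval seq_cons_def list_encode.simps)
    finally show ?thesis by (auto simp: gr0_conv_Suc)
  qed
  have "n \<in> S \<longleftrightarrow> (\<exists>y. \<forall>p. \<exists>k. beval e k (join p (join y (\<lambda>_. 0))) (seq_cons n 0) \<noteq> 0)" for n
  proof -
    have "n \<in> S \<longleftrightarrow> (\<exists>y. Q (join y (\<lambda>_. 0)) n)" using fun_cong[OF fun_cong[OF Q(2)]] by blast
    also have "\<dots> \<longleftrightarrow> (\<exists>y. \<forall>p. \<not> R (join p (join y (\<lambda>_. 0))) n)"
      using fun_cong[OF fun_cong[OF R(2)]] by blast
    also have "\<dots> \<longleftrightarrow> (\<exists>y. \<forall>p. \<exists>k. beval e k (join p (join y (\<lambda>_. 0))) (seq_cons n 0) \<noteq> 0)"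
      unfolding run ..
    finally show ?thesis .
  qed
  then show ?thesis by blast
qed

lemma Sigma1_set_2_trivial: "Sigma1_set 2 UNIV" "Sigma1_set 2 {}"
proof -
  have "semirecursive (\<lambda>p n. True)" unfolding semirecursive_def by (rule exI[of _ Zero]) simp
  then have "Sigma1 1 (\<lambda>p n. \<exists>q::baire. False)" using base[of "\<lambda>_ _. False"] by simp
  then have "Sigma1 (Suc 1) (\<lambda>p n. \<exists>q::baire. True)" using step[of 1 "\<lambda>_ _. True"] by simp
  then show "Sigma1_set 2 UNIV" by (simp add: Sigma1_set_def numeral_2_eq_2)
  have "semirecursive (\<lambda>p n. False)"
    unfolding semirecursive_def by (rule exI[of _ "Comp Succ []"]) simp
  then have "Sigma1 1 (\<lambda>p n. \<exists>q::baire. True)" using base[of "\<lambda>_ _. True"] by simp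
  then have "Sigma1 (Suc 1) (\<lambda>p n. \<exists>q::baire. False)" using step[of 1 "\<lambda>_ _. False"] by simp
  then show "Sigma1_set 2 {}" by (simp add: Sigma1_set_def numeral_2_eq_2)
qed

text \<open>
Runs a program on the left half of a joined oracle. The query position is passed through \<^const>\<open>Succ\<close>
and back so that argument lists of the wrong length still diverge.
\<close>

fun queries_left :: "recf \<Rightarrow> recf" where
  "queries_left Query = Comp Query [Comp (Comp add_prog [Proj 0, Proj 0]) [Comp pred_prog [Succ]]]"
| "queries_left (Comp f gs) = Comp (queries_left f) (map queries_left gs)"
| "queries_left (Prec f g) = Prec (queries_left f) (queries_left g)"
| "queries_left (Minim f) = Minim (queries_left f)"
| "queries_left e = e"

lemma eval_queries_left: "eval (queries_left e) (join p q) xs = eval e p xs"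
proof (induction e arbitrary: xs)
  case Query
  show ?case
    by (auto simp: eval_pred eval_add join_def split: list.splits)
next
  case (Comp f gs)
  have "map (\<lambda>g. eval g (join p q) xs) (map queries_left gs) = map (\<lambda>g. eval g p xs) gs"
    using Comp.IH(2) by simp
  then show ?case using Comp.IH(1)
    by (simp only: queries_left.simps eval.simps) (simp split: option.split)
next
  case (Prec f g)
  show ?case by (cases xs) (simp_all add: Prec.IH)
next
  case (Minim f)
  show ?case by (simp add: Minim.IH)
qed simp_all

lemma beval_agree: "agree s p p' \<Longrightarrow> beval e s p w = beval e s p' w"
  using beval_mono[of s s p p' e w] beval_mono[of s s p' p e w] unfolding agree_def by fastforce

lemma beval_mono_fuel: "beval e s p w \<noteq> 0 \<Longrightarrow> s \<le> s' \<Longrightarrow> beval e s' p w = beval e s p w"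
  by (rule beval_mono) auto

lemma agree_join: "agree s p p' \<Longrightarrow> agree s q q' \<Longrightarrow> agree s (join p q) (join p' q')"
  by (simp add: agree_def join_def)

lemma section_of_agree:
  assumes "agree k r r'" "prod_encode (N, N) \<le> k" "s \<le> N" "t < N"
  shows "section_of r s t = section_of r' s t"
proof -
  have "prod_encode (s, t) \<le> prod_encode (N, t)" by (rule prod_encode_mono) (use assms in auto)
  also have "\<dots> < prod_encode (N, N)"
    using prod_encode_mono[of N N t N] assms(4)
    by (metis nat_less_le order_refl prod.inject prod_encode_eq)
  finally show ?thesis using assms(1,2) by (simp add: section_of_def agree_def)
qed

text \<open>
The code guesses everything that the enumeration depends on. Its sections are: the resulting name in
all even sections; the index \<open>n\<close> in section 1; a witness for membership of \<open>n\<close> in \<open>S\<close> in section 3; the characteristic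
function of \<open>A\<close> in section 5; and in section \<open>7 + 2 j\<close> a witness that its value at \<open>j\<close> is right. As
both \<open>A\<close> and its complement are \<open>\<Sigma>\<^sup>1\<^sub>2\<close>, either value of the guess can be witnessed.
\<close>

lemma computable_opens_not_enumerable:
  assumes S: "Sigma1_set 2 S" and A: "Delta1_set 2 A"
    and e: "\<And>n c. n \<in> S \<Longrightarrow> eval e (join (\<lambda>_. n) (\<lambda>i. of_bool (i \<in> A))) [c] = Some (F n c)"
    and F: "\<And>n. n \<in> S \<Longrightarrow> open_space clopens (F n) = Some (f n)"
  shows "\<not> computable_opens clopens \<subseteq> f ` S"
proof
  assume all: "computable_opens clopens \<subseteq> f ` S"
  obtain eS where eS: "\<And>n. n \<in> S \<longleftrightarrow>
      (\<exists>y. \<forall>p. \<exists>k. beval eS k (join p (join y (\<lambda>_. 0))) (seq_cons n 0) \<noteq> 0)"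
    using Sigma1_set_2_normal_form[OF S] by blast
  obtain eA where eA: "\<And>n. n \<in> A \<longleftrightarrow>
      (\<exists>y. \<forall>p. \<exists>k. beval eA k (join p (join y (\<lambda>_. 0))) (seq_cons n 0) \<noteq> 0)"
    using Sigma1_set_2_normal_form[of A] A unfolding Delta1_set_def by blast
  obtain eC where eC: "\<And>n. n \<notin> A \<longleftrightarrow>
      (\<exists>y. \<forall>p. \<exists>k. beval eC k (join p (join y (\<lambda>_. 0))) (seq_cons n 0) \<noteq> 0)"
    using Sigma1_set_2_normal_form[of "- A"] A unfolding Delta1_set_def by auto
  define halts where "halts d h p r s n \<longleftrightarrow>
      beval d h (join (\<lambda>t. p (t + 3)) (join (section_of r s) (\<lambda>_. 0))) (seq_cons n 0) \<noteq> 0"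
    for d h and p r :: baire and s n
  \<comment> \<open>The fuel \<open>h\<close> is kept so far below \<open>k\<close> that all entries of the
    sections of \<open>r\<close> consulted with fuel \<open>h\<close> lie below
    \<open>k\<close>. The first three entries of \<open>p\<close> select the section, the
    oracle position and the position in the name to be verified.\<close>
  define \<tau> where "\<tau> r p k \<longleftrightarrow> (\<exists>h<k. prod_encode (2 * h + 9, 2 * h + 9) \<le> k \<and>
      p 0 < h \<and> p 1 < h \<and> p 2 < h \<and>
      halts eS h p r 3 (section_of r 1 0) \<and>
      (section_of r 5 (p 1) = 1 \<and> halts eA h p r (2 * p 1 + 7) (p 1) \<or>
       section_of r 5 (p 1) = 0 \<and> halts eC h p r (2 * p 1 + 7) (p 1)) \<and>
      beval e h (join (\<lambda>_. section_of r 1 0) (section_of r 5)) (seq_cons (p 2) 0) =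
        Suc (section_of r (2 * p 0) (p 2)))" for r p k
  have \<tau>_agree: "\<tau> r' p' k" if r: "agree k r r'" and p: "agree k p p'" and \<tau>: "\<tau> r p k" for r r' p p' k
  proof -
    obtain h where h: "h < k" and bound: "prod_encode (2 * h + 9, 2 * h + 9) \<le> k" "p 0 < h" "p 1 < h" "p 2 < h"
      and run: "halts eS h p r 3 (section_of r 1 0)"
      "section_of r 5 (p 1) = 1 \<and> halts eA h p r (2 * p 1 + 7) (p 1) \<or>
       section_of r 5 (p 1) = 0 \<and> halts eC h p r (2 * p 1 + 7) (p 1)"
      "beval e h (join (\<lambda>_. section_of r 1 0) (section_of r 5)) (seq_cons (p 2) 0) =
        Suc (section_of r (2 * p 0) (p 2))"
      using \<tau> unfolding \<tau>_def by blast
    have sec: "section_of r s t = section_of r' s t" if "s \<le> 2 * h + 9" "t < 2 * h + 9" for s t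
      using section_of_agree[OF r bound(1) that] .
    have "2 * h + 9 \<le> k" using le_prod_encode_1[of "2 * h + 9" "2 * h + 9"] bound(1) by linarith
    then have peq: "p t = p' t" if "t < 2 * h + 9" for t using p that by (simp add: agree_def)
    have p': "p' 0 = p 0" "p' 1 = p 1" "p' 2 = p 2" using peq by simp_all
    have halts: "halts d h p r s n = halts d h p' r' s n" if "s \<le> 2 * h + 9" for d s n
    proof -
      have "agree h (join (\<lambda>t. p (t + 3)) (join (section_of r s) (\<lambda>_. 0)))
          (join (\<lambda>t. p' (t + 3)) (join (section_of r' s) (\<lambda>_. 0)))"
        by (intro agree_join) (use peq sec[OF that] in \<open>auto simp: agree_def\<close>)
      then show ?thesis unfolding halts_def using beval_agree by metis
    qed
    have n: "section_of r' 1 0 = section_of r 1 0" "section_of r' 5 (p 1) = section_of r 5 (p 1)"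
      "section_of r' (2 * p 0) (p 2) = section_of r (2 * p 0) (p 2)"
      using sec bound by auto
    have "agree h (join (\<lambda>_. section_of r 1 0) (section_of r 5)) (join (\<lambda>_. section_of r 1 0) (section_of r' 5))"
      by (intro agree_join) (use sec in \<open>auto simp: agree_def\<close>)
    then have "beval e h (join (\<lambda>_. section_of r 1 0) (section_of r' 5)) (seq_cons (p 2) 0) =
        beval e h (join (\<lambda>_. section_of r 1 0) (section_of r 5)) (seq_cons (p 2) 0)"
      using beval_agree by metis
    then show ?thesis
      unfolding \<tau>_def p' n using h bound run halts[of 3] halts[of "2 * p 1 + 7"]
      by (intro exI[of _ h]) simp
  qed
  interpret exit_test \<tau>
  proof
    show "\<tau> r p k = \<tau> r' p' k" if "agree k r r'" "agree k p p'" for k r r' p p'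
      using \<tau>_agree[OF that] \<tau>_agree[OF agree_sym[OF that(1)] agree_sym[OF that(2)]] by blast
  qed
  have wf: "section_of r 1 0 \<in> S \<and> section_of r (2 * i) = F (section_of r 1 0)"
    if r: "r \<in> wellfounded_codes" for r i
  proof -
    define shift :: "nat \<Rightarrow> nat \<Rightarrow> baire \<Rightarrow> baire" where
      "shift j c p t = (if t = 0 then i else if t = 1 then j else if t = 2 then c else p (t - 3))" for j c p t
    have shift: "shift j c p 0 = i" "shift j c p 1 = j" "shift j c p 2 = c"
      "(\<lambda>t. shift j c p (t + 3)) = p" for j c p
      by (auto simp: shift_def)
    have ex: "\<exists>k. \<tau> r (shift j c p) k" for j c p using r unfolding wellfounded_codes_def by blast
    have S: "section_of r 1 0 \<in> S"
      unfolding eS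
    proof (rule exI[of _ "section_of r 3"], rule allI)
      fix p
      show "\<exists>k. beval eS k (join p (join (section_of r 3) (\<lambda>_. 0))) (seq_cons (section_of r 1 0) 0) \<noteq> 0"
        using ex[of 0 0 p] unfolding \<tau>_def halts_def shift by blast
    qed
    have "section_of r 5 j = of_bool (j \<in> A)" for j
    proof -
      have runs: "section_of r 5 j = 1 \<and> (\<exists>h. halts eA h (shift j 0 p) r (2 * j + 7) j) \<or>
          section_of r 5 j = 0 \<and> (\<exists>h. halts eC h (shift j 0 p) r (2 * j + 7) j)" for p
        using ex[of j 0 p] unfolding \<tau>_def shift by blast
      show ?thesis
      proof (cases "section_of r 5 j = 1")
        case True
        then have "\<exists>h. halts eA h (shift j 0 p) r (2 * j + 7) j" for p using runs[of p] by simp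
        then have "j \<in> A" unfolding eA halts_def shift by blast
        then show ?thesis using True by simp
      next
        case False
        then have "\<exists>h. halts eC h (shift j 0 p) r (2 * j + 7) j" for p using runs[of p] by simp
        then have "j \<notin> A" unfolding eC halts_def shift by blast
        then show ?thesis using False runs by auto
      qed
    qed
    then have chi: "section_of r 5 = (\<lambda>i. of_bool (i \<in> A))" by (rule ext)
    have "section_of r (2 * i) c = F (section_of r 1 0) c" for c
    proof -
      obtain h where "beval e h (join (\<lambda>_. section_of r 1 0) (section_of r 5)) (seq_cons c 0) =
          Suc (section_of r (2 * i) c)"
        using ex[of 0 c "\<lambda>_. 0"] unfolding \<tau>_def shift by blast
      then have "eval e (join (\<lambda>_. section_of r 1 0) (section_of r 5)) [c] = Some (section_of r (2 * i) c)"
        using eval_iff_beval[of e _ "[c]"] by (auto simp: seq_cons_def)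
      then show ?thesis using e[OF S, of c] unfolding chi by simp
    qed
    then show ?thesis using S by blast
  qed
  interpret recursive_coded_families \<tau>
  proof
    show "section_of r (2 * i) \<in> dom (open_space clopens)" if "r \<in> wellfounded_codes" for r i
      using wf[OF that, of i] F by fastforce
    show "decidable (\<lambda>x. \<tau> (\<lambda>i. r i x) (\<lambda>i. p i x) (k x))"
      if r: "total_recursive (\<lambda>e. r (pfst e) (psnd e))" and p: "total_recursive (\<lambda>e. p (pfst e) (psnd e))"
        and k: "total_recursive k" for r p k
      unfolding \<tau>_def halts_def join_def section_of_def[abs_def]
      by (intro recursive_intros k total_recursive_compose[OF k] total_recursive_compose2[OF r]
          total_recursive_compose2[OF p])
  qed
  obtain n where n: "n \<in> S" "f n = diagonal_open" using all diagonal_open_computable by fastforce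
  obtain yS where yS: "\<And>p. \<exists>k. beval eS k (join p (join yS (\<lambda>_. 0))) (seq_cons n 0) \<noteq> 0"
    using n(1) eS by blast
  have "\<exists>y. (j \<in> A \<longrightarrow> (\<forall>p. \<exists>k. beval eA k (join p (join y (\<lambda>_. 0))) (seq_cons j 0) \<noteq> 0)) \<and>
     (j \<notin> A \<longrightarrow> (\<forall>p. \<exists>k. beval eC k (join p (join y (\<lambda>_. 0))) (seq_cons j 0) \<noteq> 0))" for j
    using eA[of j] eC[of j] by blast
  then obtain y where yA: "\<And>j p. j \<in> A \<Longrightarrow> \<exists>k. beval eA k (join p (join (y j) (\<lambda>_. 0))) (seq_cons j 0) \<noteq> 0"
    and yC: "\<And>j p. j \<notin> A \<Longrightarrow> \<exists>k. beval eC k (join p (join (y j) (\<lambda>_. 0))) (seq_cons j 0) \<noteq> 0"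
    by metis
  define r where "r c = (if even (pfst c) then F n (psnd c)
     else if pfst c = 1 then n else if pfst c = 3 then yS (psnd c)
     else if pfst c = 5 then of_bool (psnd c \<in> A) else y ((pfst c - 7) div 2) (psnd c))" for c
  have sections: "section_of r (2 * i) = F n" "section_of r 1 = (\<lambda>_. n)" "section_of r 3 = yS"
    "section_of r 5 = (\<lambda>i. of_bool (i \<in> A))" "section_of r (2 * j + 7) = y j" for i j
    by (auto simp: section_of_def r_def)
  have "\<exists>k. \<tau> r p k" for p
  proof -
    have mono: "halts d h' p r s m" if "halts d h p r s m" "h \<le> h'" for d h h' s m
      using that(1) beval_mono_fuel[OF that(1)[unfolded halts_def] that(2)] unfolding halts_def by simp
    obtain h1 where h1: "halts eS h1 p r 3 n" 
      using yS[of "\<lambda>t. p (t + 3)"] unfolding halts_def sections by (rule exE)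
    obtain h2 where h2: "p 1 \<in> A \<and> halts eA h2 p r (2 * p 1 + 7) (p 1) \<or>
        p 1 \<notin> A \<and> halts eC h2 p r (2 * p 1 + 7) (p 1)"
      using yA[of "p 1" "\<lambda>t. p (t + 3)"] yC[of "p 1" "\<lambda>t. p (t + 3)"] unfolding halts_def sections
      by (cases "p 1 \<in> A") auto
    obtain h3 where h3: "beval e h3 (join (\<lambda>_. n) (\<lambda>i. of_bool (i \<in> A))) (seq_cons (p 2) 0) = Suc (F n (p 2))"
      using e[OF n(1), of "p 2"] eval_iff_beval[of e _ "[p 2]"] by (auto simp: seq_cons_def)
    define h where "h = h1 + h2 + h3 + p 0 + p 1 + p 2 + 1"
    have "beval e h (join (\<lambda>_. n) (\<lambda>i. of_bool (i \<in> A))) (seq_cons (p 2) 0) = Suc (F n (p 2))"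
      using beval_mono_fuel[of e h3 _ _ h] h3 by (simp add: h_def)
    moreover have "halts eS h p r 3 n" by (rule mono[OF h1]) (simp add: h_def)
    moreover have "p 1 \<in> A \<and> halts eA h p r (2 * p 1 + 7) (p 1) \<or>
        p 1 \<notin> A \<and> halts eC h p r (2 * p 1 + 7) (p 1)"
      using h2 mono[of _ h2 _ _ h] by (auto simp: h_def)
    ultimately have "\<tau> r p (Suc h + prod_encode (2 * h + 9, 2 * h + 9))"
      unfolding \<tau>_def sections by (intro exI[of _ h]) (auto simp: h_def)
    then show ?thesis by blast
  qed
  then have "r \<in> wellfounded_codes" unfolding wellfounded_codes_def by blast
  moreover have "open_space clopens (section_of r (2 * i)) = Some (f n)" for i
    unfolding sections using F n(1) by blast
  ultimately have "open_set_of clopens diagonal_open \<noteq> (\<Union>i::nat. open_set_of clopens (f n))"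
    by (rule diagonal_open_differs[of r "\<lambda>_. f n"])
  then show False using n(2) by simp
qed

theorem theorem6p3:
  shows "\<not> based_on (fun_space baire_space two_space) (fun_space baire_space nat_space) \<and>
    \<not> Sigma1_enumerable_opens 2 (fun_space baire_space two_space) \<and>
    (\<forall>A. Delta1_set 2 A \<longrightarrow> \<not> enumerable_opens_rel A (fun_space baire_space two_space))"
proof (intro conjI allI impI)
  show "\<not> based_on clopens (fun_space baire_space nat_space)"
    by (rule clopens_not_based_on_functionals)
  show "\<not> Sigma1_enumerable_opens 2 clopens"
  proof
    assume "Sigma1_enumerable_opens 2 clopens"
    then obtain S f F e where S: "Sigma1_set 2 S" "f ` S = computable_opens clopens"
      and e: "\<And>p n. p \<in> dom (subspace_of nat_space S) \<Longrightarrow> eval e p [n] = Some (F p n)"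
      and F: "realizes (subspace_of nat_space S) (open_space clopens) F f"
      unfolding Sigma1_enumerable_opens_def computable_fun_def computable_on_def by blast
    have name: "subspace_of nat_space S (\<lambda>_. n) = Some n" if "n \<in> S" for n
      using that by (simp add: subspace_of_def nat_space_def)
    have "\<not> computable_opens clopens \<subseteq> f ` S"
    proof (rule computable_opens_not_enumerable[where A = "{}" and F = "\<lambda>n. F (\<lambda>_. n)"])
      show "Delta1_set 2 {}" using Sigma1_set_2_trivial by (simp add: Delta1_set_def)
      show "eval (queries_left e) (join (\<lambda>_. n) (\<lambda>i. of_bool (i \<in> {}))) [c] = Some (F (\<lambda>_. n) c)"
        if "n \<in> S" for n c
        using e name[OF that] unfolding eval_queries_left by blast
      show "open_space clopens (F (\<lambda>_. n)) = Some (f n)" if "n \<in> S" for n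
        using F name[OF that] unfolding realizes_def by blast
    qed (rule S(1))
    then show False using S(2) by simp
  qed
  fix A assume A: "Delta1_set 2 A"
  show "\<not> enumerable_opens_rel A clopens"
  proof
    assume "enumerable_opens_rel A clopens"
    then obtain f F e where f: "computable_opens clopens \<subseteq> range f"
      and e: "\<And>p n. p \<in> dom nat_space \<Longrightarrow> eval e (join p (\<lambda>i. of_bool (i \<in> A))) [n] = Some (F p n)"
      and F: "realizes nat_space (open_space clopens) F f"
      unfolding enumerable_opens_rel_def computable_fun_rel_def computable_on_rel_def by blast
    have name: "nat_space (\<lambda>_. n) = Some n" for n by (simp add: nat_space_def)
    have "\<not> computable_opens clopens \<subseteq> range f"
    proof (rule computable_opens_not_enumerable[where F = "\<lambda>n. F (\<lambda>_. n)", OF Sigma1_set_2_trivial(1) A])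
      show "eval e (join (\<lambda>_. n) (\<lambda>i. of_bool (i \<in> A))) [c] = Some (F (\<lambda>_. n) c)" for n c
        using e name by blast
      show "open_space clopens (F (\<lambda>_. n)) = Some (f n)" for n
        using F name unfolding realizes_def by blast
    qed
    then show False using f by blast
  qed
qed

end
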